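(* Let $G$ be a finite group acting freely on a compactly generated Hausdorff path connected space $X$ with basepoint $x_0$, and let $p:X\to X/G$ be the orbit map. Then for all $n\ge 1$ the homomorphism $$p_*:\sigma_n(X,x_0,G)\to \tau_n(X/G,p(x_0))$$ from the $n$-th Rhodes group of $(X,G)$ to the $n$-th Fox torus homotopy group of $X/G$ is an isomorphism.
   Context: Let $I=[0,1]$, let $T^{m}$ denote the $m$-dimensional torus ($T^0$ is a point), and for $n\ge 1$ put $C_n=I\times T^{n-1}$. For spaces $A,Z$, $Z^A$ is the space of maps $A\to Z$. Fox torus homotopy groups: for a space $Z$ with basepoint $z_0$, $\tau_n(Z,z_0)=\pi_1(Z^{T^{n-1}},c_{z_0})$, where $c_{z_0}$ is the constant map at $z_0$. Rhodes groups: let $X$ be a $G$-space with basepoint $x_0$. A map $f:C_n\to X$ is of order $g\in G$ if $f(0,t_2,\ldots,t_n)=x_0$ and $f(1,t_2,\ldots,t_n)=gx_0$ for all $(t_2,\ldots,t_n)\in T^{n-1}$. Let $[f;g]$ denote the homotopy class of $f$ through maps of order $g$ (together with $g$), and let $\sigma_n(X,x_0,G)$ be the set of all such classes. It is a group under $[f';g']*[f;g]=[f'+g'f;\,g'g]$, where $g'f$ is the map $f$ followed by the action of $g'$ and $+$ denotes concatenation in the $I$-coordinate. The homomorphism $p_*$ sends $[f;g]$ to the class of the loop $I\to (X/G)^{T^{n-1}}$ adjoint to the composite $C_n=I\times T^{n-1}\xrightarrow{f}X\xrightarrow{p}X/G$. *)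

theory Defs
  imports "HOL-Analysis.Analysis" "HOL-Algebra.Group_Action"
begin

section \<open>Tori, cylinders and mapping spaces\<close>

definition torus :: "nat \<Rightarrow> (nat \<Rightarrow> complex) topology" where
  "torus m = product_topology (\<lambda>_. top_of_set (sphere 0 1)) {..<m}"

definition cylinder :: "nat \<Rightarrow> (real \<times> (nat \<Rightarrow> complex)) topology" where
  "cylinder n = prod_topology (top_of_set {0..1}) (torus (n - 1))"

text \<open>The space of maps from \<open>A\<close> to \<open>Z\<close> with the compact-open topology. A map is represented by
  the function that is \<open>undefined\<close> outside \<open>topspace A\<close>, so that distinct points are distinct
  maps. Taking \<open>K\<close> empty shows that its points are all the maps.\<close>

definition maps :: "'a topology \<Rightarrow> 'b topology \<Rightarrow> ('a \<Rightarrow> 'b) set" where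
  "maps A Z = {f \<in> extensional (topspace A). continuous_map A Z f}"

definition mapping_space :: "'a topology \<Rightarrow> 'b topology \<Rightarrow> ('a \<Rightarrow> 'b) topology" where
  "mapping_space A Z = topology_generated_by
     {{f \<in> maps A Z. f ` K \<subseteq> U} | K U. compactin A K \<and> openin Z U}"

lemma topspace_mapping_space: "topspace (mapping_space A Z) = maps A Z"
proof -
  have "maps A Z \<in> {{f \<in> maps A Z. f ` K \<subseteq> U} | K U. compactin A K \<and> openin Z U}"
    by (rule CollectI, rule exI[of _ "{}"], rule exI[of _ "{}"]) auto
  then show ?thesis
    unfolding mapping_space_def topology_generated_by_topspace by auto
qed


section \<open>Fundamental group and Fox torus homotopy groups\<close>

text \<open>The library has path homotopies only for type-class spaces, so they are restated here for
  abstract topologies. Note that \<open>homotopic_with\<close> includes continuity of both of its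
  arguments, and that it identifies functions that differ only outside the domain.\<close>

definition loop_at :: "'b \<Rightarrow> (real \<Rightarrow> 'b) \<Rightarrow> bool" where
  "loop_at z r \<longleftrightarrow> r 0 = z \<and> r 1 = z"

definition loop_class :: "'b topology \<Rightarrow> 'b \<Rightarrow> (real \<Rightarrow> 'b) \<Rightarrow> (real \<Rightarrow> 'b) set" where
  "loop_class Z z r = {r'. homotopic_with (loop_at z) (top_of_set {0..1}) Z r r'}"

definition loop_concat :: "(real \<Rightarrow> 'b) \<Rightarrow> (real \<Rightarrow> 'b) \<Rightarrow> real \<Rightarrow> 'b" where
  "loop_concat r r' = (\<lambda>s. if s \<le> 1/2 then r (2 * s) else r' (2 * s - 1))"

text \<open>Operations on homotopy classes are defined without choosing representatives, as the union
  of the classes obtained from all representatives (as for products of cosets); this union is a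
  single class exactly because the operation is well defined on classes.\<close>

definition fundamental_group :: "'b topology \<Rightarrow> 'b \<Rightarrow> (real \<Rightarrow> 'b) set monoid" where
  "fundamental_group Z z =
    \<lparr>carrier = {loop_class Z z r | r. continuous_map (top_of_set {0..1}) Z r \<and> loop_at z r},
     mult = (\<lambda>A B. \<Union>r\<in>A. \<Union>r'\<in>B. loop_class Z z (loop_concat r r')),
     one = loop_class Z z (\<lambda>_. z)\<rparr>"

definition fox_group ::
    "nat \<Rightarrow> 'b topology \<Rightarrow> 'b \<Rightarrow> (real \<Rightarrow> (nat \<Rightarrow> complex) \<Rightarrow> 'b) set monoid" where
  "fox_group n Z z = fundamental_group (mapping_space (torus (n - 1)) Z)
     (\<lambda>t\<in>topspace (torus (n - 1)). z)"


section \<open>Orbit spaces and Rhodes groups\<close>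

definition orbit_space ::
    "('g, 'm) monoid_scheme \<Rightarrow> ('g \<Rightarrow> 'a \<Rightarrow> 'a) \<Rightarrow> 'a topology \<Rightarrow> 'a set topology" where
  "orbit_space G \<phi> X = topology (\<lambda>U. U \<subseteq> orbits G (topspace X) \<phi> \<and>
     openin X {x \<in> topspace X. orbit G \<phi> x \<in> U})"

lemma openin_orbit_space:
  "openin (orbit_space G \<phi> X) U \<longleftrightarrow> U \<subseteq> orbits G (topspace X) \<phi> \<and>
     openin X {x \<in> topspace X. orbit G \<phi> x \<in> U}"
proof -
  let ?p = "\<lambda>U. {x \<in> topspace X. orbit G \<phi> x \<in> U}"
  have I: "?p (S \<inter> T) = ?p S \<inter> ?p T" for S T by auto
  have U: "?p (\<Union>K) = (\<Union>S\<in>K. ?p S)" for K by auto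
  have "istopology (\<lambda>U. U \<subseteq> orbits G (topspace X) \<phi> \<and> openin X (?p U))"
    unfolding istopology_def by (auto simp only: I U intro!: openin_Int openin_Union)
  then show ?thesis
    unfolding orbit_space_def by (simp add: topology_inverse')
qed

lemma topspace_orbit_space: "topspace (orbit_space G \<phi> X) = orbits G (topspace X) \<phi>"
proof -
  have "{x \<in> topspace X. orbit G \<phi> x \<in> orbits G (topspace X) \<phi>} = topspace X"
    by (auto simp: orbits_def)
  then have "openin (orbit_space G \<phi> X) (orbits G (topspace X) \<phi>)"
    by (simp add: openin_orbit_space)
  then show ?thesis
    by (metis openin_orbit_space openin_subset openin_topspace subset_antisym)
qed

lemma quotient_map_orbit: "quotient_map X (orbit_space G \<phi> X) (orbit G \<phi>)"
  unfolding quotient_map_def topspace_orbit_space openin_orbit_space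
  by (auto simp: orbits_def)

text \<open>\<open>G\<close> is discrete, so continuity of the action amounts to continuity of each \<open>\<phi> g\<close>.\<close>

definition G_space ::
    "('g, 'm) monoid_scheme \<Rightarrow> 'a topology \<Rightarrow> ('g \<Rightarrow> 'a \<Rightarrow> 'a) \<Rightarrow> bool" where
  "G_space G X \<phi> \<longleftrightarrow>
     group_action G (topspace X) \<phi> \<and> (\<forall>g\<in>carrier G. continuous_map X X (\<phi> g))"

definition free_action ::
    "('g, 'm) monoid_scheme \<Rightarrow> 'a topology \<Rightarrow> ('g \<Rightarrow> 'a \<Rightarrow> 'a) \<Rightarrow> bool" where
  "free_action G X \<phi> \<longleftrightarrow>
     (\<forall>g\<in>carrier G. \<forall>x\<in>topspace X. \<phi> g x = x \<longrightarrow> g = \<one>\<^bsub>G\<^esub>)"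

definition of_order ::
    "nat \<Rightarrow> 'a \<Rightarrow> ('g \<Rightarrow> 'a \<Rightarrow> 'a) \<Rightarrow> 'g \<Rightarrow> (real \<times> (nat \<Rightarrow> complex) \<Rightarrow> 'a) \<Rightarrow> bool" where
  "of_order n x0 \<phi> g f \<longleftrightarrow>
     (\<forall>t\<in>topspace (torus (n - 1)). f (0, t) = x0 \<and> f (1, t) = \<phi> g x0)"

definition rhodes_class ::
    "nat \<Rightarrow> 'a topology \<Rightarrow> 'a \<Rightarrow> ('g \<Rightarrow> 'a \<Rightarrow> 'a) \<Rightarrow> (real \<times> (nat \<Rightarrow> complex) \<Rightarrow> 'a) \<Rightarrow> 'g \<Rightarrow>
      (real \<times> (nat \<Rightarrow> complex) \<Rightarrow> 'a) set \<times> 'g" where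
  "rhodes_class n X x0 \<phi> f g =
     ({f'. homotopic_with (of_order n x0 \<phi> g) (cylinder n) X f f'}, g)"

definition cyl_concat :: "(real \<times> 'c \<Rightarrow> 'a) \<Rightarrow> (real \<times> 'c \<Rightarrow> 'a) \<Rightarrow> real \<times> 'c \<Rightarrow> 'a" where
  "cyl_concat f f' = (\<lambda>(s, t). if s \<le> 1/2 then f (2 * s, t) else f' (2 * s - 1, t))"

definition rhodes_group ::
    "nat \<Rightarrow> 'a topology \<Rightarrow> 'a \<Rightarrow> ('g, 'm) monoid_scheme \<Rightarrow> ('g \<Rightarrow> 'a \<Rightarrow> 'a) \<Rightarrow>
      ((real \<times> (nat \<Rightarrow> complex) \<Rightarrow> 'a) set \<times> 'g) monoid" where
  "rhodes_group n X x0 G \<phi> =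
    \<lparr>carrier = {rhodes_class n X x0 \<phi> f g | f g.
        g \<in> carrier G \<and> continuous_map (cylinder n) X f \<and> of_order n x0 \<phi> g f},
     mult = (\<lambda>(A, g') (B, g).
        (\<Union>f'\<in>A. \<Union>f\<in>B. fst (rhodes_class n X x0 \<phi> (cyl_concat f' (\<phi> g' \<circ> f)) (g' \<otimes>\<^bsub>G\<^esub> g)),
         g' \<otimes>\<^bsub>G\<^esub> g)),
     one = rhodes_class n X x0 \<phi> (\<lambda>_. x0) \<one>\<^bsub>G\<^esub>\<rparr>"


section \<open>The homomorphism induced by the orbit map\<close>

definition adjoint_loop ::
    "nat \<Rightarrow> (real \<times> (nat \<Rightarrow> complex) \<Rightarrow> 'b) \<Rightarrow> real \<Rightarrow> (nat \<Rightarrow> complex) \<Rightarrow> 'b" where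
  "adjoint_loop n h = (\<lambda>s. \<lambda>t\<in>topspace (torus (n - 1)). h (s, t))"

definition orbit_map_induced ::
    "nat \<Rightarrow> 'a topology \<Rightarrow> 'a \<Rightarrow> ('g, 'm) monoid_scheme \<Rightarrow> ('g \<Rightarrow> 'a \<Rightarrow> 'a) \<Rightarrow>
      (real \<times> (nat \<Rightarrow> complex) \<Rightarrow> 'a) set \<times> 'g \<Rightarrow>
      (real \<Rightarrow> (nat \<Rightarrow> complex) \<Rightarrow> 'a set) set" where
  "orbit_map_induced n X x0 G \<phi> = (\<lambda>(A, g). \<Union>f\<in>A.
     loop_class (mapping_space (torus (n - 1)) (orbit_space G \<phi> X))
       (\<lambda>t\<in>topspace (torus (n - 1)). orbit G \<phi> x0)
       (adjoint_loop n (orbit G \<phi> \<circ> f)))"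

end

theory Submission
  imports Defs
begin

text \<open>
  Because \<open>G\<close> is finite and acts freely on a Hausdorff space, the orbit map \<open>p: X \<rightarrow> X/G\<close> is a
  covering whose sheets are permuted simply transitively by \<open>G\<close>. The isomorphism is covering
  theory with a torus of parameters.

  The exponential law (\<open>continuous_map_curry\<close>, \<open>continuous_map_uncurry\<close>) turns a loop of maps
  \<open>T \<rightarrow> X/G\<close>, with \<open>T\<close> the torus of dimension \<open>n - 1\<close>, into a map \<open>I \<times> T \<rightarrow> X/G\<close>, and a homotopy
  of such loops into a map \<open>I \<times> (I \<times> T) \<rightarrow> X/G\<close>; here it matters that \<open>T\<close> is compact Hausdorff.
  Such maps are lifted to \<open>X\<close> along their first interval (\<open>homotopy_lifting\<close>), starting from the
  constant map at \<open>x0\<close>.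

  Surjectivity (\<open>adj_surj\<close>): the lift of a loop ends in the fibre over the base point. The fibre
  is discrete and \<open>T\<close> is connected, so the end is constant, equal to \<open>g x0\<close> for some \<open>g\<close>, and
  the lift is a map of order \<open>g\<close>.
  Injectivity (\<open>adj_homotopic_imp\<close>): let the projections of \<open>f\<close>, of order \<open>g\<close>, and \<open>f'\<close>, of order
  \<open>g'\<close>, be homotopic as loops. Lift the homotopy. Lifts are determined by one value on a
  connected space (\<open>lifts_unique\<close>), so the lift runs from \<open>f\<close> to \<open>f'\<close>, and its end is constant.
  Hence \<open>g x0 = g' x0\<close>, which gives \<open>g = g'\<close> by freeness, and the lift is a homotopy through
  maps of order \<open>g\<close>.
  The product is preserved because \<open>p\<close> does not see the translation by \<open>g'\<close> in \<open>f' + g'f\<close>.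

  That the Rhodes product is well defined and satisfies the group laws is then read off from the
  Fox group through this injection. The Fox group is the fundamental group of a mapping space;
  its group laws are reparametrizations of loops (\<open>group_fundamental_group\<close>).
\<close>

section \<open>The fundamental group of an abstract topological space\<close>

abbreviation unit_interval :: "real topology" where
  "unit_interval \<equiv> top_of_set {0..1}"

abbreviation loop_homotopic :: "'b topology \<Rightarrow> 'b \<Rightarrow> (real \<Rightarrow> 'b) \<Rightarrow> (real \<Rightarrow> 'b) \<Rightarrow> bool" where
  "loop_homotopic Z z \<equiv> homotopic_with (loop_at z) unit_interval Z"

lemma continuous_map_into_unit_interval:
  assumes "continuous_map A euclideanreal u" and "\<And>x. x \<in> topspace A \<Longrightarrow> 0 \<le> u x \<and> u x \<le> 1"
  shows "continuous_map A unit_interval u"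
  using assms by (auto simp: continuous_map_in_subtopology)

lemma continuous_map_fst_real:
  "continuous_map (prod_topology unit_interval A) euclideanreal fst"
  using continuous_map_fst[of unit_interval A] by (simp add: continuous_map_in_subtopology)

text \<open>The parameter space \<open>A\<close> serves twice: a torus gives the concatenation of maps on a cylinder,
  an interval gives the concatenation of homotopies of loops.\<close>

lemma continuous_map_cyl_concat:
  assumes f: "continuous_map (prod_topology unit_interval A) Z f"
    and f': "continuous_map (prod_topology unit_interval A) Z f'"
    and match: "\<And>x. x \<in> topspace A \<Longrightarrow> f (1, x) = f' (0, x)"
  shows "continuous_map (prod_topology unit_interval A) Z (cyl_concat f f')"
proof -
  let ?P = "prod_topology unit_interval A"
  have eq: "cyl_concat f f' = (\<lambda>w. if fst w \<le> 1/2 then (f \<circ> (\<lambda>w. (2 * fst w, snd w))) w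
                 else (f' \<circ> (\<lambda>w. (2 * fst w - 1, snd w))) w)"
    by (auto simp: cyl_concat_def fun_eq_iff)
  have lo: "continuous_map (subtopology ?P {w \<in> topspace ?P. fst w \<le> 1/2}) ?P (\<lambda>w. (2 * fst w, snd w))"
    by (intro continuous_map_pairedI continuous_map_into_unit_interval continuous_map_real_mult
          continuous_map_from_subtopology continuous_map_fst_real continuous_map_snd) auto
  have hi: "continuous_map (subtopology ?P {w \<in> topspace ?P. 1/2 \<le> fst w}) ?P (\<lambda>w. (2 * fst w - 1, snd w))"
    by (intro continuous_map_pairedI continuous_map_into_unit_interval continuous_map_real_mult
          continuous_map_diff continuous_map_from_subtopology continuous_map_fst_real continuous_map_snd) auto
  show ?thesis
    unfolding eq
  proof (rule continuous_map_cases_le)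
    show "continuous_map (subtopology ?P {w \<in> topspace ?P. fst w \<le> 1/2}) Z (f \<circ> (\<lambda>w. (2 * fst w, snd w)))"
      by (rule continuous_map_compose[OF lo f])
    show "continuous_map (subtopology ?P {w \<in> topspace ?P. 1/2 \<le> fst w}) Z (f' \<circ> (\<lambda>w. (2 * fst w - 1, snd w)))"
      by (rule continuous_map_compose[OF hi f'])
    show "(f \<circ> (\<lambda>w. (2 * fst w, snd w))) w = (f' \<circ> (\<lambda>w. (2 * fst w - 1, snd w))) w"
      if "w \<in> topspace ?P" "fst w = 1/2" for w
    proof -
      obtain x where "w = (1/2, x)" "x \<in> topspace A"
        using \<open>w \<in> topspace ?P\<close> \<open>fst w = 1/2\<close> by (cases w) auto
      with match show ?thesis by simp
    qed
  qed (simp_all add: continuous_map_fst_real)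
qed

lemma loop_class_eq_iff:
  assumes "continuous_map unit_interval Z r'" and "loop_at z r'"
  shows "loop_class Z z r = loop_class Z z r' \<longleftrightarrow> loop_homotopic Z z r r'"
proof
  assume "loop_class Z z r = loop_class Z z r'"
  moreover have "r' \<in> loop_class Z z r'"
    using assms by (simp add: loop_class_def)
  ultimately show "loop_homotopic Z z r r'"
    by (simp add: loop_class_def set_eq_iff)
next
  assume "loop_homotopic Z z r r'"
  then show "loop_class Z z r = loop_class Z z r'"
    unfolding loop_class_def by (auto intro: homotopic_with_trans homotopic_with_symD)
qed

lemma loop_homotopic_imp_class_eq:
  "loop_homotopic Z z r r' \<Longrightarrow> loop_class Z z r = loop_class Z z r'"
  unfolding loop_class_def by (auto intro: homotopic_with_trans homotopic_with_symD)

lemma loop_homotopic_concat: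
  assumes "loop_homotopic Z z r\<^sub>0 r\<^sub>1" and "loop_homotopic Z z r\<^sub>0' r\<^sub>1'"
  shows "loop_homotopic Z z (loop_concat r\<^sub>0 r\<^sub>0') (loop_concat r\<^sub>1 r\<^sub>1')"
proof -
  let ?S = "prod_topology unit_interval unit_interval"
  obtain h where h: "continuous_map ?S Z h" "\<And>s. h (0, s) = r\<^sub>0 s" "\<And>s. h (1, s) = r\<^sub>1 s"
      "\<And>u. u \<in> {0..1} \<Longrightarrow> loop_at z (\<lambda>s. h (u, s))"
    using assms(1) by (auto simp: homotopic_with_def)
  obtain h' where h': "continuous_map ?S Z h'" "\<And>s. h' (0, s) = r\<^sub>0' s" "\<And>s. h' (1, s) = r\<^sub>1' s"
      "\<And>u. u \<in> {0..1} \<Longrightarrow> loop_at z (\<lambda>s. h' (u, s))"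
    using assms(2) by (auto simp: homotopic_with_def)
  \<comment> \<open>The loop parameter has to come first for the concatenation, hence the swaps.\<close>
  define k where "k = cyl_concat (h \<circ> prod.swap) (h' \<circ> prod.swap) \<circ> prod.swap"
  have k: "k (u, s) = loop_concat (\<lambda>s. h (u, s)) (\<lambda>s. h' (u, s)) s" for u s
    by (simp add: k_def cyl_concat_def loop_concat_def)
  have swap: "continuous_map ?S ?S prod.swap"
    unfolding prod.swap_def by (intro continuous_map_pairedI continuous_map_fst continuous_map_snd)
  have "(h \<circ> prod.swap) (1, u) = (h' \<circ> prod.swap) (0, u)" if "u \<in> topspace unit_interval" for u
    using that h(4)[of u] h'(4)[of u] by (simp add: loop_at_def)
  then have "continuous_map ?S Z k"
    unfolding k_def
    by (intro continuous_map_compose[OF swap continuous_map_cyl_concat]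
          continuous_map_compose[OF swap h(1)] continuous_map_compose[OF swap h'(1)])
  then show ?thesis
    unfolding homotopic_with_def
    by (intro exI[of _ k]) (use h h' in \<open>auto simp: k loop_concat_def loop_at_def\<close>)
qed

lemma continuous_loop_concat:
  assumes "continuous_map unit_interval Z r" "loop_at z r"
    and "continuous_map unit_interval Z r'" "loop_at z r'"
  shows "continuous_map unit_interval Z (loop_concat r r')" and "loop_at z (loop_concat r r')"
  using loop_homotopic_concat[of z Z r r r' r'] assms by simp_all

text \<open>The interval is convex, so \<open>a\<close> and \<open>b\<close> are joined by a straight line, along which the
  common end points stay fixed. The group laws of the fundamental group are instances: both sides
  of each law are reparametrizations of a single loop.\<close>

lemma loop_homotopic_reparametrize:
  assumes r: "continuous_map unit_interval Z r"
    and a: "continuous_map unit_interval unit_interval a"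
    and b: "continuous_map unit_interval unit_interval b"
    and ends: "a 0 = b 0" "a 1 = b 1" "r (a 0) = z" "r (a 1) = z"
  shows "loop_homotopic Z z (r \<circ> a) (r \<circ> b)"
proof -
  let ?S = "prod_topology unit_interval unit_interval"
  have real: "continuous_map ?S euclideanreal (c \<circ> snd)"
    if "continuous_map unit_interval unit_interval c" for c
    using that by (intro continuous_map_compose[OF continuous_map_snd])
      (simp add: continuous_map_in_subtopology)
  have rng: "a s \<in> {0..1}" "b s \<in> {0..1}" if "s \<in> {0..1}" for s
    using that a b by (auto simp: continuous_map_in_subtopology)
  have conv: "0 \<le> (1 - u) * x + u * y \<and> (1 - u) * x + u * y \<le> 1"
    if "u \<in> {0..1}" "x \<in> {0..1}" "y \<in> {0..1}" for u x y :: real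
    using convexD[OF convex_real_interval(5)[of 0 1] that(2,3), of "1 - u" u] that(1) by auto
  have "continuous_map ?S unit_interval
          (\<lambda>w. (1 - fst w) * (a \<circ> snd) w + fst w * (b \<circ> snd) w)"
    using a b rng conv
    by (intro continuous_map_into_unit_interval continuous_map_add continuous_map_real_mult
          continuous_map_diff continuous_map_fst_real real) auto
  then have "continuous_map ?S Z (r \<circ> (\<lambda>w. (1 - fst w) * (a \<circ> snd) w + fst w * (b \<circ> snd) w))"
    by (rule continuous_map_compose[OF _ r])
  then show ?thesis
    unfolding homotopic_with_def
    by (intro exI[of _ "r \<circ> (\<lambda>w. (1 - fst w) * (a \<circ> snd) w + fst w * (b \<circ> snd) w)"])
       (use ends in \<open>auto simp: loop_at_def algebra_simps\<close>)
qed

lemma fundamental_group_mult: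
  assumes "continuous_map unit_interval Z r" "loop_at z r"
    and "continuous_map unit_interval Z r'" "loop_at z r'"
  shows "loop_class Z z r \<otimes>\<^bsub>fundamental_group Z z\<^esub> loop_class Z z r'
       = loop_class Z z (loop_concat r r')"
proof -
  have eq: "loop_class Z z (loop_concat q q') = loop_class Z z (loop_concat r r')"
    if "q \<in> loop_class Z z r" "q' \<in> loop_class Z z r'" for q q'
  proof -
    have "loop_homotopic Z z (loop_concat r r') (loop_concat q q')"
      using that by (intro loop_homotopic_concat) (simp_all add: loop_class_def)
    from loop_homotopic_imp_class_eq[OF this] show ?thesis by simp
  qed
  have "r \<in> loop_class Z z r" "r' \<in> loop_class Z z r'"
    using assms by (simp_all add: loop_class_def)
  then have "loop_class Z z r \<noteq> {}" "loop_class Z z r' \<noteq> {}"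
    by auto
  moreover have "(\<Union>q\<in>loop_class Z z r. \<Union>q'\<in>loop_class Z z r'. loop_class Z z (loop_concat q q'))
      = (\<Union>q\<in>loop_class Z z r. \<Union>q'\<in>loop_class Z z r'. loop_class Z z (loop_concat r r'))"
    by (intro SUP_cong refl eq)
  ultimately show ?thesis
    by (simp add: fundamental_group_def)
qed

lemma loop_class_eqI:
  assumes "continuous_map unit_interval Z r" "loop_at z r"
    and "\<And>s. s \<in> {0..1} \<Longrightarrow> r s = r' s"
  shows "loop_class Z z r = loop_class Z z r'"
  using assms by (intro loop_homotopic_imp_class_eq homotopic_with_equal) (auto simp: loop_at_def)

text \<open>Associativity and the left unit reparametrize a loop by a piecewise linear map that fixes the end
  points of the interval. For the left inverse, a reversed loop followed by the loop itself is the
  loop run along \<open>\<bar>1 - 2 s\<bar>\<close>, which starts and ends at \<open>1\<close> and so contracts to the constant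
  map \<open>1\<close>.\<close>

theorem group_fundamental_group:
  assumes z: "z \<in> topspace Z"
  shows "group (fundamental_group Z z)"
proof (rule groupI)
  let ?F = "fundamental_group Z z"
  have const: "continuous_map unit_interval Z (\<lambda>_. z)" "loop_at z (\<lambda>_. z)"
    using z by (simp_all add: loop_at_def)
  have carrier: "carrier ?F = {loop_class Z z r | r. continuous_map unit_interval Z r \<and> loop_at z r}"
    and one: "\<one>\<^bsub>?F\<^esub> = loop_class Z z (\<lambda>_. z)"
    by (simp_all add: fundamental_group_def)
  have reparam: "loop_class Z z q = loop_class Z z (r \<circ> b)"
    if "continuous_map unit_interval Z r" "loop_at z r"
      and "continuous_on {0..1} a" "a ` {0..1} \<subseteq> {0..1}" "continuous_on {0..1} b" "b ` {0..1} \<subseteq> {0..1}"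
      and "a 0 = b 0" "a 1 = b 1" "a 0 \<in> {0, 1}" "a 1 \<in> {0, 1}"
      and "\<And>s. s \<in> {0..1} \<Longrightarrow> q s = r (a s)" for q r and a b :: "real \<Rightarrow> real"
  proof -
    have ab: "loop_homotopic Z z (r \<circ> a) (r \<circ> b)"
      using that by (intro loop_homotopic_reparametrize) (auto simp: loop_at_def)
    have "loop_class Z z (r \<circ> a) = loop_class Z z q"
    proof (rule loop_class_eqI)
      show "continuous_map unit_interval Z (r \<circ> a)" "loop_at z (r \<circ> a)"
        using homotopic_with_imp_continuous_maps[OF ab] homotopic_with_imp_property[OF ab] by auto
    qed (simp add: that(11))
    with loop_homotopic_imp_class_eq[OF ab] show ?thesis by simp
  qed
  show "x \<otimes>\<^bsub>?F\<^esub> y \<in> carrier ?F" if xy: "x \<in> carrier ?F" "y \<in> carrier ?F" for x y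
  proof -
    obtain q r where q: "x = loop_class Z z q" "continuous_map unit_interval Z q" "loop_at z q"
      and r: "y = loop_class Z z r" "continuous_map unit_interval Z r" "loop_at z r"
      using xy unfolding carrier by blast
    then have "x \<otimes>\<^bsub>?F\<^esub> y = loop_class Z z (loop_concat q r)"
      by (simp add: fundamental_group_mult)
    then show ?thesis
      unfolding carrier using continuous_loop_concat[OF q(2,3) r(2,3)] by auto
  qed
  show "\<one>\<^bsub>?F\<^esub> \<in> carrier ?F"
    unfolding carrier one using const by auto
  show "x \<otimes>\<^bsub>?F\<^esub> y \<otimes>\<^bsub>?F\<^esub> w = x \<otimes>\<^bsub>?F\<^esub> (y \<otimes>\<^bsub>?F\<^esub> w)"
    if xyw: "x \<in> carrier ?F" "y \<in> carrier ?F" "w \<in> carrier ?F" for x y w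
  proof -
    obtain p q r where
      p: "x = loop_class Z z p" "continuous_map unit_interval Z p" "loop_at z p" and
      q: "y = loop_class Z z q" "continuous_map unit_interval Z q" "loop_at z q" and
      r: "w = loop_class Z z r" "continuous_map unit_interval Z r" "loop_at z r"
      using xyw unfolding carrier by blast
    note pq = continuous_loop_concat[OF p(2,3) q(2,3)] and qr = continuous_loop_concat[OF q(2,3) r(2,3)]
    have "loop_class Z z (loop_concat (loop_concat p q) r)
        = loop_class Z z (loop_concat p (loop_concat q r) \<circ> (\<lambda>s. s))"
    \<comment> \<open>The reparametrization is concave with slopes 2, 1, 1/2, hence a minimum of three lines.\<close>
    proof (rule reparam[where a = "\<lambda>s. min (2 * s) (min (s + 1/4) ((s + 1) / 2))"])
      show "loop_concat (loop_concat p q) r s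
          = loop_concat p (loop_concat q r) (min (2 * s) (min (s + 1/4) ((s + 1) / 2)))"
        if "s \<in> {0..1}" for s
      proof -
        consider "s \<le> 1/4" | "1/4 < s" "s \<le> 1/2" | "1/2 < s" by linarith
        then show ?thesis
        proof cases
          case 1
          then have "min (2 * s) (min (s + 1/4) ((s + 1) / 2)) = 2 * s"
            by (simp add: min_def)
          with 1 show ?thesis by (simp add: loop_concat_def)
        next
          case 2
          then have "min (2 * s) (min (s + 1/4) ((s + 1) / 2)) = s + 1/4"
            by (simp add: min_def)
          with 2 show ?thesis by (simp add: loop_concat_def algebra_simps)
        next
          case 3
          then have "min (2 * s) (min (s + 1/4) ((s + 1) / 2)) = (s + 1) / 2"
            by (simp add: min_def)
          with 3 show ?thesis by (simp add: loop_concat_def algebra_simps add_divide_distrib)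
        qed
      qed
      show "continuous_map unit_interval Z (loop_concat p (loop_concat q r))"
          "loop_at z (loop_concat p (loop_concat q r))"
        by (rule continuous_loop_concat[OF p(2,3) qr])+
      show "continuous_on {0..1} (\<lambda>s::real. min (2 * s) (min (s + 1/4) ((s + 1) / 2)))"
        by (intro continuous_intros) auto
      show "(\<lambda>s::real. min (2 * s) (min (s + 1/4) ((s + 1) / 2))) ` {0..1} \<subseteq> {0..1}"
        by (auto simp: min_le_iff_disj)
    qed auto
    then show ?thesis
      unfolding p(1) q(1) r(1) fundamental_group_mult[OF p(2,3) q(2,3)]
        fundamental_group_mult[OF q(2,3) r(2,3)] fundamental_group_mult[OF pq r(2,3)]
        fundamental_group_mult[OF p(2,3) qr] by (simp add: o_def)
  qed
  show "\<one>\<^bsub>?F\<^esub> \<otimes>\<^bsub>?F\<^esub> x = x" if x: "x \<in> carrier ?F" for x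
  proof -
    obtain r where r: "x = loop_class Z z r" "continuous_map unit_interval Z r" "loop_at z r"
      using x unfolding carrier by blast
    have "loop_class Z z (loop_concat (\<lambda>_. z) r) = loop_class Z z (r \<circ> (\<lambda>s. s))"
    proof (rule reparam[where a = "\<lambda>s. max 0 (2 * s - 1)"])
      show "loop_concat (\<lambda>_. z) r s = r (max 0 (2 * s - 1))" for s
        using r(3) by (cases "s \<le> 1/2") (simp_all add: loop_concat_def loop_at_def max_absorb1 max_absorb2)
      show "continuous_on {0..1} (\<lambda>s::real. max 0 (2 * s - 1))"
        by (intro continuous_intros)
    qed (use r(2,3) in auto)
    then show ?thesis
      unfolding one r(1) fundamental_group_mult[OF const r(2,3)] by (simp add: o_def)
  qed
  show "\<exists>y\<in>carrier ?F. y \<otimes>\<^bsub>?F\<^esub> x = \<one>\<^bsub>?F\<^esub>" if x: "x \<in> carrier ?F" for x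
  proof -
    obtain r where r: "x = loop_class Z z r" "continuous_map unit_interval Z r" "loop_at z r"
      using x unfolding carrier by blast
    have "continuous_map unit_interval Z (r \<circ> (\<lambda>s. 1 - s))"
    proof (rule continuous_map_compose[OF _ r(2)])
      show "continuous_map unit_interval unit_interval (\<lambda>s. 1 - s)"
        by (rule continuous_map_into_unit_interval) (auto intro!: continuous_on_diff)
    qed
    then have rev: "continuous_map unit_interval Z (\<lambda>s. r (1 - s))" "loop_at z (\<lambda>s. r (1 - s))"
      using r(3) by (auto simp: loop_at_def o_def)
    have "loop_class Z z (loop_concat (\<lambda>s. r (1 - s)) r) = loop_class Z z (r \<circ> (\<lambda>s. 1))"
    proof (rule reparam[where a = "\<lambda>s. \<bar>1 - 2 * s\<bar>"])
      show "loop_concat (\<lambda>s. r (1 - s)) r s = r \<bar>1 - 2 * s\<bar>" for s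
        by (simp add: loop_concat_def abs_if)
      show "continuous_on {0..1} (\<lambda>s::real. \<bar>1 - 2 * s\<bar>)"
        by (intro continuous_intros)
    qed (use r(2,3) in auto)
    then have "loop_class Z z (\<lambda>s. r (1 - s)) \<otimes>\<^bsub>?F\<^esub> x = \<one>\<^bsub>?F\<^esub>"
      using r(3) unfolding one r(1) fundamental_group_mult[OF rev r(2,3)]
      by (simp add: o_def loop_at_def)
    moreover have "loop_class Z z (\<lambda>s. r (1 - s)) \<in> carrier ?F"
      unfolding carrier by (intro CollectI exI conjI) (rule refl rev)+
    ultimately show ?thesis by blast
  qed
qed

section \<open>The exponential law and tori\<close>

text \<open>Over a compact \<open>K\<close>, the tube lemma turns \<open>{a} \<times> K \<subseteq> W\<close> with \<open>W\<close> open into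
  \<open>V \<times> K \<subseteq> W\<close> for a neighbourhood \<open>V\<close> of \<open>a\<close>, which is continuity on a subbasic open set of the
  compact-open topology.\<close>

lemma continuous_map_curry:
  assumes h: "continuous_map (prod_topology A T) Z h"
  shows "continuous_map A (mapping_space T Z) (\<lambda>a. \<lambda>t\<in>topspace T. h (a, t))"
proof -
  let ?F = "\<lambda>a. \<lambda>t\<in>topspace T. h (a, t)"
  have maps: "?F a \<in> maps T Z" if "a \<in> topspace A" for a
  proof -
    have "continuous_map T Z (h \<circ> Pair a)"
      by (rule continuous_map_o_Pair[OF h that])
    then show ?thesis
      unfolding maps_def by (auto intro: continuous_map_eq)
  qed
  have "openin A (?F -` {f \<in> maps T Z. f ` K \<subseteq> U} \<inter> topspace A)"
    if K: "compactin T K" and U: "openin Z U" for K U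
  proof (subst openin_subopen, intro ballI)
    fix a
    assume a: "a \<in> ?F -` {f \<in> maps T Z. f ` K \<subseteq> U} \<inter> topspace A"
    let ?W = "{w \<in> topspace (prod_topology A T). h w \<in> U}"
    have KT: "K \<subseteq> topspace T"
      by (rule compactin_subset_topspace[OF K])
    have "openin (prod_topology A T) ?W"
      by (rule openin_continuous_map_preimage[OF h U])
    moreover have "{a} \<times> K \<subseteq> ?W"
      using a KT by auto
    ultimately obtain V V' where V: "openin A V" "a \<in> V" "K \<subseteq> V'" "V \<times> V' \<subseteq> ?W"
      using tube_lemma_right[of A T ?W K a] K a by auto
    have "V \<subseteq> ?F -` {f \<in> maps T Z. f ` K \<subseteq> U} \<inter> topspace A"
    proof
      fix b assume b: "b \<in> V"
      then have "b \<in> topspace A"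
        using openin_subset[OF V(1)] by auto
      moreover have "h (b, t) \<in> U" if "t \<in> K" for t
        using that b V(3,4) by auto
      ultimately show "b \<in> ?F -` {f \<in> maps T Z. f ` K \<subseteq> U} \<inter> topspace A"
        using maps KT by auto
    qed
    with V show "\<exists>V. openin A V \<and> a \<in> V \<and> V \<subseteq> ?F -` {f \<in> maps T Z. f ` K \<subseteq> U} \<inter> topspace A"
      by blast
  qed
  moreover have "?F ` topspace A \<subseteq> topspace (mapping_space T Z)"
    unfolding topspace_mapping_space using maps by auto
  ultimately show ?thesis
    unfolding mapping_space_def topology_generated_by_topspace
    by (intro continuous_on_generated_topo) auto
qed

text \<open>Near \<open>(a, t)\<close>, a compact neighbourhood \<open>K\<close> of \<open>t\<close> with \<open>F a ` K \<subseteq> U\<close> gives a subbasic open set of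
  the mapping space, whose preimage times \<open>K\<close> is mapped into \<open>U\<close>.\<close>

lemma continuous_map_uncurry:
  assumes T: "neighbourhood_base_of (compactin T) T"
    and F: "continuous_map A (mapping_space T Z) F"
  shows "continuous_map (prod_topology A T) Z (\<lambda>(a, t). F a t)"
proof -
  have maps: "continuous_map T Z (F a)" if "a \<in> topspace A" for a
  proof -
    have "F a \<in> maps T Z"
      using continuous_map_image_subset_topspace[OF F] that topspace_mapping_space[of T Z] by auto
    then show ?thesis by (simp add: maps_def)
  qed
  have "openin (prod_topology A T) {w \<in> topspace (prod_topology A T). (case w of (a, t) \<Rightarrow> F a t) \<in> U}"
    if U: "openin Z U" for U
    unfolding openin_prod_topology_alt
  proof (intro allI impI)
    fix a t
    assume "(a, t) \<in> {w \<in> topspace (prod_topology A T). (case w of (a, t) \<Rightarrow> F a t) \<in> U}"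
    then have at: "a \<in> topspace A" "t \<in> topspace T" "F a t \<in> U"
      by auto
    have "openin T {t \<in> topspace T. F a t \<in> U}"
      by (rule openin_continuous_map_preimage[OF maps[OF at(1)] U])
    then obtain V K where V: "openin T V" "compactin T K" "t \<in> V" "V \<subseteq> K" "K \<subseteq> {t \<in> topspace T. F a t \<in> U}"
      using T at unfolding neighbourhood_base_of by (metis (no_types, lifting) mem_Collect_eq)
    let ?O = "{f \<in> maps T Z. f ` K \<subseteq> U}"
    let ?B = "{b \<in> topspace A. F b \<in> ?O}"
    have "openin (mapping_space T Z) ?O"
      unfolding mapping_space_def using V(2) U by (intro topology_generated_by_Basis) auto
    then have "openin A ?B"
      by (rule openin_continuous_map_preimage[OF F])
    moreover have "a \<in> ?B"
      using at V(5) continuous_map_image_subset_topspace[OF F] topspace_mapping_space[of T Z] by auto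
    moreover have "?B \<times> V \<subseteq> {w \<in> topspace (prod_topology A T). (case w of (a, t) \<Rightarrow> F a t) \<in> U}"
      using V(4) openin_subset[OF V(1)] by auto
    ultimately show "\<exists>B V. openin A B \<and> openin T V \<and> a \<in> B \<and> t \<in> V \<and>
        B \<times> V \<subseteq> {w \<in> topspace (prod_topology A T). (case w of (a, t) \<Rightarrow> F a t) \<in> U}"
      using V by blast
  qed
  moreover have "(\<lambda>(a, t). F a t) \<in> topspace (prod_topology A T) \<rightarrow> topspace Z"
    using continuous_map_image_subset_topspace[OF maps] by auto
  ultimately show ?thesis
    by (simp add: continuous_map_def)
qed

lemma torus_nonempty: "topspace (torus m) \<noteq> {}"
  by (simp add: torus_def PiE_eq_empty_iff)

lemma compact_space_torus: "compact_space (torus m)"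
  unfolding torus_def compact_space_product_topology
  by (simp add: compact_space_subtopology compactin_euclidean_iff)

lemma Hausdorff_space_torus: "Hausdorff_space (torus m)"
  unfolding torus_def Hausdorff_space_product_topology
  by (simp add: Hausdorff_space_subtopology)

lemma connected_space_torus: "connected_space (torus m)"
proof -
  have "connected (sphere (0::complex) 1)"
    by (rule connected_sphere) simp
  then show ?thesis
    unfolding torus_def connected_space_product_topology
    by (simp add: connected_space_subtopology)
qed

lemma torus_compact_neighbourhoods: "neighbourhood_base_of (compactin (torus m)) (torus m)"
  using compact_space_torus Hausdorff_space_torus compact_imp_locally_compact_space
    locally_compact_space_neighbourhood_base by blast

section \<open>The covering defined by a free action of a finite group\<close>

locale free_finite_action =
  fixes G :: "('g, 'm) monoid_scheme" (structure)
    and X :: "'a topology"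
    and \<phi> :: "'g \<Rightarrow> 'a \<Rightarrow> 'a"
  assumes finite_carrier: "finite (carrier G)"
    and G_space: "G_space G X \<phi>"
    and free: "free_action G X \<phi>"
    and Hausdorff: "Hausdorff_space X"
begin

sublocale group_action G "topspace X" \<phi>
  using G_space by (simp add: G_space_def)

sublocale group G
  using group_hom by (rule group_hom.axioms(1))

abbreviation p :: "'a \<Rightarrow> 'a set" where "p \<equiv> orbit G \<phi>"

abbreviation Q :: "'a set topology" where "Q \<equiv> orbit_space G \<phi> X"

lemma act_closed: "\<lbrakk>g \<in> carrier G; x \<in> topspace X\<rbrakk> \<Longrightarrow> \<phi> g x \<in> topspace X"
  using element_image by blast

lemma act_one: "x \<in> topspace X \<Longrightarrow> \<phi> \<one> x = x"
  by (metis id_eq_one restrict_apply')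

lemma act_continuous: "g \<in> carrier G \<Longrightarrow> continuous_map X X (\<phi> g)"
  using G_space by (simp add: G_space_def)

lemma act_inj:
  assumes "g \<in> carrier G" "h \<in> carrier G" "x \<in> topspace X" "\<phi> g x = \<phi> h x"
  shows "g = h"
proof -
  have "\<phi> (inv h \<otimes> g) x = x"
    using assms by (simp add: composition_rule orbit_sym_aux)
  then have "inv h \<otimes> g = \<one>"
    using free assms unfolding free_action_def by auto
  then show ?thesis
    using assms by (metis inv_equality inv_inv inv_closed)
qed

lemma p_act: "\<lbrakk>g \<in> carrier G; x \<in> topspace X\<rbrakk> \<Longrightarrow> p (\<phi> g x) = p x"
proof -
  assume g: "g \<in> carrier G" and x: "x \<in> topspace X"
  have "\<phi> h (\<phi> g x) \<in> p x" if "h \<in> carrier G" for h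
    using composition_rule[OF x that g] m_closed[OF that g] unfolding orbit_def
    by (metis (mono_tags, lifting) mem_Collect_eq)
  moreover have "\<phi> h x \<in> p (\<phi> g x)" if h: "h \<in> carrier G" for h
  proof -
    have "\<phi> h x = \<phi> (h \<otimes> inv g) (\<phi> g x)"
      using h g x by (simp add: m_assoc flip: composition_rule)
    then show ?thesis
      unfolding orbit_def using h g by blast
  qed
  ultimately show ?thesis
    unfolding orbit_def by blast
qed

lemma p_eq_obtain:
  assumes "x \<in> topspace X" "y \<in> topspace X" "p x = p y"
  obtains g where "g \<in> carrier G" "y = \<phi> g x"
  using orbit_refl[OF assms(2)] assms(3) unfolding orbit_def by blast

lemma continuous_map_p: "continuous_map X Q p"
  by (rule quotient_imp_continuous_map[OF quotient_map_orbit])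

lemma openin_p_image:
  assumes "openin X U"
  shows "openin Q (p ` U)"
proof -
  have UX: "U \<subseteq> topspace X"
    by (rule openin_subset[OF assms])
  have "{x \<in> topspace X. p x \<in> p ` U} = (\<Union>g\<in>carrier G. {x \<in> topspace X. \<phi> g x \<in> U})"
    (is "?L = ?R")
  proof
    show "?L \<subseteq> ?R"
    proof
      fix x assume "x \<in> ?L"
      then obtain u where u: "x \<in> topspace X" "u \<in> U" "p x = p u" by blast
      obtain g where "g \<in> carrier G" "u = \<phi> g x"
        using p_eq_obtain[OF u(1) subsetD[OF UX u(2)] u(3)] by blast
      with u show "x \<in> ?R" by blast
    qed
    show "?R \<subseteq> ?L"
    proof
      fix x assume "x \<in> ?R"
      then obtain g where "g \<in> carrier G" "x \<in> topspace X" "\<phi> g x \<in> U" by blast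
      moreover from this have "p x \<in> p ` U"
        using imageI[of "\<phi> g x" U p] p_act by simp
      ultimately show "x \<in> ?L" by blast
    qed
  qed
  moreover have "openin X ?R"
    using assms act_continuous openin_continuous_map_preimage by fast
  ultimately show ?thesis
    unfolding openin_orbit_space orbits_def using UX by auto
qed

text \<open>For \<open>g \<in> G\<close> the set where \<open>f' = g f\<close> is closed, as \<open>X\<close> is Hausdorff. By freeness these sets
  are disjoint, and they cover \<open>Y\<close>, as \<open>f\<close> and \<open>f'\<close> have equal projections. There are finitely
  many of them, so each is also open. This gives uniqueness of lifts without evenly covered sets.\<close>

lemma clopen_lifts_differ_by:
  assumes f: "continuous_map Y X f" and f': "continuous_map Y X f'"
    and lifts: "\<And>y. y \<in> topspace Y \<Longrightarrow> p (f y) = p (f' y)"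
    and g: "g \<in> carrier G"
  shows "closedin Y {y \<in> topspace Y. f' y = \<phi> g (f y)}"
    and "openin Y {y \<in> topspace Y. f' y = \<phi> g (f y)}"
proof -
  let ?E = "\<lambda>g. {y \<in> topspace Y. f' y = \<phi> g (f y)}"
  have fX: "f y \<in> topspace X" "f' y \<in> topspace X" if "y \<in> topspace Y" for y
    using that f f' by (auto simp: continuous_map_def)
  have closed: "closedin Y (?E h)" if "h \<in> carrier G" for h
    using closedin_continuous_maps_eq[OF Hausdorff f' continuous_map_compose[OF f act_continuous[OF that]]]
    by simp
  have "?E g = topspace Y - \<Union>(?E ` (carrier G - {g}))"
  proof (intro equalityI subsetI)
    fix y assume y: "y \<in> ?E g"
    then have "h = g" if "h \<in> carrier G" "y \<in> ?E h" for h
      using that by (intro act_inj[OF that(1) g fX(1)[of y]]) auto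
    with y show "y \<in> topspace Y - \<Union>(?E ` (carrier G - {g}))"
      by blast
  next
    fix y assume y: "y \<in> topspace Y - \<Union>(?E ` (carrier G - {g}))"
    then obtain h where "h \<in> carrier G" "f' y = \<phi> h (f y)"
      using p_eq_obtain[OF fX[of y] lifts[of y]] by blast
    with y show "y \<in> ?E g" by blast
  qed
  moreover have "closedin Y (\<Union>(?E ` (carrier G - {g})))"
    using finite_carrier closed by (intro closedin_Union) auto
  ultimately show "openin Y (?E g)"
    by (simp add: openin_closedin_eq Diff_Diff_Int closedin_subset inf.absorb2)
  show "closedin Y (?E g)"
    by (rule closed[OF g])
qed

lemma lifts_unique:
  assumes Y: "connected_space Y"
    and f: "continuous_map Y X f" and f': "continuous_map Y X f'"
    and lifts: "\<And>y. y \<in> topspace Y \<Longrightarrow> p (f y) = p (f' y)"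
    and y0: "y0 \<in> topspace Y" "f y0 = f' y0"
    and y: "y \<in> topspace Y"
  shows "f y = f' y"
proof -
  let ?E = "{y \<in> topspace Y. f' y = \<phi> \<one> (f y)}"
  have fX: "f y \<in> topspace X" if "y \<in> topspace Y" for y
    using that f by (auto simp: continuous_map_def)
  have "?E = {} \<or> ?E = topspace Y"
    using Y clopen_lifts_differ_by[OF f f' lifts one_closed] unfolding connected_space_clopen_in by blast
  moreover have "y0 \<in> ?E"
    using y0 act_one[OF fX[OF y0(1)]] by simp
  ultimately have "y \<in> ?E" using y by blast
  then show ?thesis using fX[OF y] by (simp add: act_one)
qed

text \<open>For each \<open>g \<noteq> 1\<close> the points \<open>x\<close> and \<open>g x\<close> have disjoint neighbourhoods; \<open>U\<close> is the
  intersection of the finitely many neighbourhoods of \<open>x\<close> obtained from them.\<close>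

lemma translates_disjoint_nbhd:
  assumes x: "x \<in> topspace X"
  obtains U where "openin X U" "x \<in> U" "\<And>g y. \<lbrakk>g \<in> carrier G; y \<in> U; \<phi> g y \<in> U\<rbrakk> \<Longrightarrow> g = \<one>"
proof -
  have "\<exists>U. openin X U \<and> x \<in> U \<and> (\<forall>y\<in>U. \<phi> g y \<notin> U)" if g: "g \<in> carrier G - {\<one>}" for g
  proof -
    have "x \<noteq> \<phi> g x"
      using free g x unfolding free_action_def by force
    then obtain V W where VW: "openin X V" "openin X W" "x \<in> V" "\<phi> g x \<in> W" "disjnt V W"
      using Hausdorff g x act_closed unfolding Hausdorff_space_def by (metis DiffD1)
    have "openin X (V \<inter> {y \<in> topspace X. \<phi> g y \<in> W})"
      using VW g by (intro openin_Int openin_continuous_map_preimage[OF act_continuous]) auto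
    moreover have "x \<in> V \<inter> {y \<in> topspace X. \<phi> g y \<in> W}"
      using VW x by simp
    moreover have "\<phi> g y \<notin> V" if "y \<in> V \<inter> {y \<in> topspace X. \<phi> g y \<in> W}" for y
      using that VW(5) unfolding disjnt_iff by blast
    ultimately show ?thesis by blast
  qed
  then obtain U where U: "\<And>g. g \<in> carrier G - {\<one>} \<Longrightarrow> openin X (U g) \<and> x \<in> U g \<and> (\<forall>y\<in>U g. \<phi> g y \<notin> U g)"
    by metis
  show thesis
  proof
    show "openin X (\<Inter>(U ` (carrier G - {\<one>})) \<inter> topspace X)"
      using finite_carrier U by (intro openin_INT) auto
    show "x \<in> \<Inter>(U ` (carrier G - {\<one>})) \<inter> topspace X"
      using U x by blast
    show "g = \<one>" if "g \<in> carrier G" "y \<in> \<Inter>(U ` (carrier G - {\<one>})) \<inter> topspace X"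
        "\<phi> g y \<in> \<Inter>(U ` (carrier G - {\<one>})) \<inter> topspace X" for g y
      using that U by blast
  qed
qed

text \<open>On a set disjoint from its translates by all \<open>g \<noteq> 1\<close>, the open map \<open>p\<close> is injective, so its inverse there
  is continuous.\<close>

lemma local_section:
  assumes x: "x \<in> topspace X"
  obtains U \<sigma> where "openin X U" "x \<in> U" "continuous_map (subtopology Q (p ` U)) X \<sigma>"
    "\<And>y. y \<in> U \<Longrightarrow> \<sigma> (p y) = y"
proof -
  obtain U where U: "openin X U" "x \<in> U" "\<And>g y. \<lbrakk>g \<in> carrier G; y \<in> U; \<phi> g y \<in> U\<rbrakk> \<Longrightarrow> g = \<one>"
    using translates_disjoint_nbhd[OF x] by blast
  have UX: "U \<subseteq> topspace X"
    by (rule openin_subset[OF U(1)])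
  have inj: "inj_on p U"
  proof
    fix y z assume yz: "y \<in> U" "z \<in> U" "p y = p z"
    then obtain g where g: "g \<in> carrier G" "z = \<phi> g y"
      using p_eq_obtain[of y z] UX by blast
    with U(3)[OF g(1) yz(1)] yz(2) have "g = \<one>" by simp
    with g act_one[of y] yz(1) UX show "y = z" by auto
  qed
  let ?s = "inv_into U p"
  have s: "?s (p y) = y" if "y \<in> U" for y
    using inj that by simp
  have "openin (subtopology Q (p ` U)) {b \<in> topspace (subtopology Q (p ` U)). ?s b \<in> V}"
    if V: "openin X V" for V
  proof -
    have "{b \<in> topspace (subtopology Q (p ` U)). ?s b \<in> V} = p ` (U \<inter> V)"
      using openin_subset[OF openin_p_image[OF U(1)]] s by auto
    moreover have "openin (subtopology Q (p ` U)) (p ` (U \<inter> V))"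
      using openin_p_image[OF openin_Int[OF U(1) V]] openin_p_image[OF U(1)]
      by (auto simp: openin_open_subtopology)
    ultimately show ?thesis by simp
  qed
  moreover have "?s \<in> topspace (subtopology Q (p ` U)) \<rightarrow> topspace X"
    using s UX by auto
  ultimately have "continuous_map (subtopology Q (p ` U)) X ?s"
    by (simp add: continuous_map_def)
  then show thesis
    using that U s by blast
qed

end

section \<open>Homotopy lifting\<close>

text \<open>The Lebesgue number argument, with a number that is uniform in \<open>a\<close> because \<open>A\<close> is compact.\<close>

lemma compact_cylinder_subdivision:
  assumes A: "compact_space A"
    and opens: "\<And>W. W \<in> \<W> \<Longrightarrow> openin (prod_topology unit_interval A) W"
    and cover: "topspace (prod_topology unit_interval A) \<subseteq> \<Union>\<W>"
  obtains N :: nat where "N > 0"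
    "\<And>k a. \<lbrakk>k < N; a \<in> topspace A\<rbrakk> \<Longrightarrow>
       \<exists>V W. openin A V \<and> a \<in> V \<and> W \<in> \<W> \<and> {real k / real N..real (Suc k) / real N} \<times> V \<subseteq> W"
proof -
  let ?P = "prod_topology unit_interval A"
  \<comment> \<open>The factor 2 leaves room: around a point of the e-ball, the e-ball still lies in the 2e-ball.\<close>
  have "\<exists>e V W. 0 < e \<and> openin A V \<and> snd w \<in> V \<and> W \<in> \<W> \<and> (ball (fst w) (2 * e) \<inter> {0..1}) \<times> V \<subseteq> W"
    if w: "w \<in> topspace ?P" for w
  proof -
    obtain W where W: "w \<in> W" "W \<in> \<W>"
      using cover w by blast
    then obtain U V where U: "openin unit_interval U" "openin A V" "fst w \<in> U" "snd w \<in> V" "U \<times> V \<subseteq> W"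
      using opens[OF W(2)] unfolding openin_prod_topology_alt by (metis prod.collapse)
    then obtain d where d: "0 < d" "ball (fst w) d \<inter> {0..1} \<subseteq> U"
      unfolding openin_contains_ball by blast
    then have "0 < d / 2" "(ball (fst w) (2 * (d / 2)) \<inter> {0..1}) \<times> V \<subseteq> W"
      using U(5) by auto
    with U W show ?thesis by blast
  qed
  then obtain e V W where e: "\<And>w. w \<in> topspace ?P \<Longrightarrow> 0 < e w"
    and V: "\<And>w. w \<in> topspace ?P \<Longrightarrow> openin A (V w)" "\<And>w. w \<in> topspace ?P \<Longrightarrow> snd w \<in> V w"
    and W: "\<And>w. w \<in> topspace ?P \<Longrightarrow> W w \<in> \<W>"
      "\<And>w. w \<in> topspace ?P \<Longrightarrow> (ball (fst w) (2 * e w) \<inter> {0..1}) \<times> V w \<subseteq> W w"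
    by metis
  let ?C = "\<lambda>w. (ball (fst w) (e w) \<inter> {0..1}) \<times> V w"
  have P: "compact_space ?P"
    using A by (simp add: compact_space_prod_topology compact_space_subtopology)
  have C: "\<forall>U\<in>?C ` topspace ?P. openin ?P U"
  proof
    fix U assume "U \<in> ?C ` topspace ?P"
    then obtain w where w: "w \<in> topspace ?P" "U = ?C w" by blast
    have "openin unit_interval (ball (fst w) (e w) \<inter> {0..1})"
      by (metis Int_commute open_ball openin_open_Int)
    then show "openin ?P U"
      unfolding w(2) openin_prod_Times_iff using V(1)[OF w(1)] by simp
  qed
  have "topspace ?P \<subseteq> \<Union>(?C ` topspace ?P)"
  proof
    fix w assume w: "w \<in> topspace ?P"
    then have "w \<in> ?C w"
      using e[OF w] V(2)[OF w] by (cases w) auto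
    with w show "w \<in> \<Union>(?C ` topspace ?P)" by blast
  qed
  with P C obtain \<F> where \<F>: "finite \<F>" "\<F> \<subseteq> ?C ` topspace ?P" "topspace ?P \<subseteq> \<Union>\<F>"
    unfolding compact_space_alt by (elim allE[of _ "?C ` topspace ?P"]) auto
  obtain F where F: "F \<subseteq> topspace ?P" "finite F" "\<F> = ?C ` F"
    using finite_subset_image[OF \<F>(1,2)] by auto
  \<comment> \<open>The 1 keeps the minimum meaningful when A, and with it F, is empty.\<close>
  define d where "d = Min (insert 1 (e ` F))"
  have d: "0 < d" "\<And>w. w \<in> F \<Longrightarrow> d \<le> e w"
    unfolding d_def using F e by auto
  then obtain m where m: "inverse (real (Suc m)) < d"
    using reals_Archimedean by blast
  show thesis
  proof (rule that[of "Suc m"])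
    fix k a
    assume k: "k < Suc m" and a: "a \<in> topspace A"
    define t where "t = real k / real (Suc m)"
    have t': "real (Suc k) / real (Suc m) = t + inverse (real (Suc m))"
      by (simp add: t_def field_simps)
    have t: "0 \<le> t" "t + inverse (real (Suc m)) \<le> 1"
      using k unfolding t'[symmetric] by (simp_all add: t_def)
    moreover have "0 < inverse (real (Suc m))"
      by simp
    ultimately have "t \<le> 1"
      by linarith
    then have "(t, a) \<in> topspace ?P"
      using a t(1) by simp
    then obtain w where w: "w \<in> F" "(t, a) \<in> ?C w"
      using \<F>(3) unfolding F(3) by blast
    have "{t..t + inverse (real (Suc m))} \<subseteq> ball (fst w) (2 * e w) \<inter> {0..1}"
      using w t m d(2)[OF w(1)] by (auto simp: dist_real_def)
    moreover have "w \<in> topspace ?P"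
      using w(1) F(1) by blast
    ultimately have "{t..t + inverse (real (Suc m))} \<times> V w \<subseteq> W w" "openin A (V w)" "W w \<in> \<W>" "a \<in> V w"
      using V(1) W w(2) by blast+
    then show "\<exists>V W. openin A V \<and> a \<in> V \<and> W \<in> \<W>
        \<and> {real k / real (Suc m)..real (Suc k) / real (Suc m)} \<times> V \<subseteq> W"
      unfolding t' t_def[symmetric] by blast
  qed simp
qed

context free_finite_action
begin

text \<open>With the section over a set that may be larger than \<open>B\<close>, the condition passes from \<open>B\<close> to its
  subsets, such as the images of thin slices of a cylinder, which are rarely open.\<close>

definition evenly_covered :: "'a set set \<Rightarrow> bool" where
  "evenly_covered B \<longleftrightarrow> (\<exists>U \<sigma>. U \<subseteq> topspace X \<and> B \<subseteq> p ` U \<and>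
     continuous_map (subtopology Q (p ` U)) X \<sigma> \<and> (\<forall>y\<in>U. \<sigma> (p y) = y))"

lemma evenly_covered_nbhd:
  assumes "b \<in> topspace Q"
  obtains B where "openin Q B" "b \<in> B" "evenly_covered B"
proof -
  obtain x where x: "x \<in> topspace X" "b = p x"
    using assms unfolding topspace_orbit_space orbits_def by blast
  obtain U \<sigma> where U: "openin X U" "x \<in> U" "continuous_map (subtopology Q (p ` U)) X \<sigma>"
      "\<And>y. y \<in> U \<Longrightarrow> \<sigma> (p y) = y"
    using local_section[OF x(1)] by blast
  show thesis
  proof (rule that[of "p ` U"])
    show "evenly_covered (p ` U)"
      unfolding evenly_covered_def using openin_subset[OF U(1)] U(3,4) by blast
  qed (use U x openin_p_image in auto)
qed

text \<open>The section supplies a lift of \<open>k\<close>; a translation by some \<open>g\<close> moves its value at \<open>y\<close> to \<open>x\<close>.\<close>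

lemma lift_through_section:
  assumes B: "evenly_covered B"
    and k: "continuous_map Y Q k" "k ` topspace Y \<subseteq> B"
    and x: "x \<in> topspace X" "y \<in> topspace Y" "p x = k y"
  obtains l where "continuous_map Y X l" "\<And>z. z \<in> topspace Y \<Longrightarrow> p (l z) = k z" "l y = x"
proof -
  obtain U \<sigma> where U: "U \<subseteq> topspace X" "B \<subseteq> p ` U" "continuous_map (subtopology Q (p ` U)) X \<sigma>"
      "\<And>y. y \<in> U \<Longrightarrow> \<sigma> (p y) = y"
    using B unfolding evenly_covered_def by blast
  have \<sigma>: "\<sigma> (k z) \<in> topspace X \<and> p (\<sigma> (k z)) = k z" if z: "z \<in> topspace Y" for z
  proof -
    obtain u where "u \<in> U" "k z = p u"
      using k(2) U(2) z by blast
    with U(1,4) show ?thesis by auto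
  qed
  obtain g where g: "g \<in> carrier G" "x = \<phi> g (\<sigma> (k y))"
    using p_eq_obtain[of "\<sigma> (k y)" x] \<sigma>[OF x(2)] x by auto
  have "continuous_map Y (subtopology Q (p ` U)) k"
    using k U(2) by (intro continuous_map_into_subtopology) auto
  then have "continuous_map Y X (\<sigma> \<circ> k)"
    by (rule continuous_map_compose[OF _ U(3)])
  then have "continuous_map Y X (\<phi> g \<circ> (\<sigma> \<circ> k))"
    by (rule continuous_map_compose[OF _ act_continuous[OF g(1)]])
  then show thesis
    by (rule that) (use g \<sigma> p_act in auto)
qed

text \<open>Over \<open>I \<times> V\<close> a section lifts \<open>H\<close> so that it starts at \<open>f a\<close>. The start agrees with \<open>f\<close> on a
  neighbourhood \<open>V'\<close> of \<open>a\<close>, since the set where two lifts agree is open. Two such local lifts agree over a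
  common point of \<open>A\<close>, by uniqueness of lifts of the path over that point, so they paste.\<close>

lemma lift_step:
  assumes H: "continuous_map (prod_topology unit_interval A) Q H"
    and f: "continuous_map A X f" "\<And>a. a \<in> topspace A \<Longrightarrow> p (f a) = H (0, a)"
    and small: "\<And>a. a \<in> topspace A \<Longrightarrow> \<exists>V. openin A V \<and> a \<in> V \<and> evenly_covered (H ` ({0..1} \<times> V))"
  obtains L where "continuous_map (prod_topology unit_interval A) X L"
    "\<And>w. w \<in> topspace (prod_topology unit_interval A) \<Longrightarrow> p (L w) = H w"
    "\<And>a. a \<in> topspace A \<Longrightarrow> L (0, a) = f a"
proof -
  let ?P = "prod_topology unit_interval A"
  define local_lift where "local_lift V L \<longleftrightarrow>
      continuous_map (subtopology ?P ({0..1} \<times> V)) X L \<and>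
      (\<forall>w\<in>{0..1} \<times> V. p (L w) = H w) \<and> (\<forall>b\<in>V. L (0, b) = f b)" for V L
  have "\<exists>V L. openin A V \<and> a \<in> V \<and> local_lift V L"
    if a: "a \<in> topspace A" for a
  proof -
    obtain V where V: "openin A V" "a \<in> V" "evenly_covered (H ` ({0..1} \<times> V))"
      using small[OF a] by blast
    let ?S = "subtopology ?P ({0..1} \<times> V)"
    have VA: "V \<subseteq> topspace A"
      by (rule openin_subset[OF V(1)])
    have S: "topspace ?S = {0..1} \<times> V"
      using VA by auto
    have HS: "continuous_map ?S Q H"
      by (rule continuous_map_from_subtopology[OF H])
    have fa: "f a \<in> topspace X"
      using f(1) a by (auto simp: continuous_map_def)
    have "(0, a) \<in> topspace ?S"
      using S V(2) by simp
    then obtain l where l: "continuous_map ?S X l" "\<And>w. w \<in> topspace ?S \<Longrightarrow> p (l w) = H w" "l (0, a) = f a"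
      using lift_through_section[OF V(3) HS _ fa _ f(2)[OF a]] S by auto
    have "continuous_map (subtopology A V) ?S (Pair 0)"
    proof (rule continuous_map_into_subtopology)
      show "continuous_map (subtopology A V) ?P (Pair 0)"
        by (intro continuous_map_pairedI continuous_map_from_subtopology continuous_map_id[unfolded id_def]) auto
    qed auto
    then have l0: "continuous_map (subtopology A V) X (l \<circ> Pair 0)"
      by (rule continuous_map_compose[OF _ l(1)])
    have fV: "continuous_map (subtopology A V) X f"
      by (rule continuous_map_from_subtopology[OF f(1)])
    \<comment> \<open>Acting by the unit has no effect; this form matches the clopen sets of lifts.\<close>
    define V' where "V' = {b \<in> topspace (subtopology A V). f b = \<phi> \<one> ((l \<circ> Pair 0) b)}"
    have "openin (subtopology A V) V'"
      unfolding V'_def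
      by (rule clopen_lifts_differ_by(2)[OF l0 fV _ one_closed]) (use VA l(2) S f(2) in auto)
    then have V': "openin A V'" "V' \<subseteq> V"
      using V(1) by (auto simp: openin_open_subtopology)
    have lX: "l (0, b) \<in> topspace X" if "b \<in> V" for b
      using l(1) that S by (auto simp: continuous_map_def)
    have "a \<in> V'"
      unfolding V'_def using V(2) a l(3) lX[OF V(2)] by (simp add: act_one)
    moreover have "continuous_map (subtopology ?P ({0..1} \<times> V')) X l"
      by (rule continuous_map_from_subtopology_mono[OF l(1)]) (use V'(2) in auto)
    moreover have "\<forall>w\<in>{0..1} \<times> V'. p (l w) = H w"
      using l(2) S V'(2) by blast
    moreover have "\<forall>b\<in>V'. l (0, b) = f b"
    proof
      fix b assume b: "b \<in> V'"
      then have "f b = \<phi> \<one> (l (0, b))"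
        by (simp add: V'_def)
      with b V'(2) lX[of b] show "l (0, b) = f b"
        by (auto simp: act_one)
    qed
    ultimately show ?thesis
      unfolding local_lift_def using V'(1) by blast
  qed
  then obtain V L where V: "\<And>a. a \<in> topspace A \<Longrightarrow> openin A (V a)" "\<And>a. a \<in> topspace A \<Longrightarrow> a \<in> V a"
    and VL: "\<And>a. a \<in> topspace A \<Longrightarrow> local_lift (V a) (L a)"
    by metis
  have L: "\<And>a. a \<in> topspace A \<Longrightarrow> continuous_map (subtopology ?P ({0..1} \<times> V a)) X (L a)"
      "\<And>a w. a \<in> topspace A \<Longrightarrow> w \<in> {0..1} \<times> V a \<Longrightarrow> p (L a w) = H w"
      "\<And>a b. a \<in> topspace A \<Longrightarrow> b \<in> V a \<Longrightarrow> L a (0, b) = f b"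
    using VL unfolding local_lift_def by blast+
  have path: "continuous_map unit_interval X (\<lambda>t. L a (t, c))"
    if "a \<in> topspace A" "c \<in> V a" for a c
  proof -
    have "c \<in> topspace A"
      using openin_subset[OF V(1)[OF that(1)]] that(2) by auto
    then have "continuous_map unit_interval (subtopology ?P ({0..1} \<times> V a)) (\<lambda>t. (t, c))"
      using that(2)
      by (intro continuous_map_into_subtopology continuous_map_pairedI continuous_map_id[unfolded id_def]) auto
    from continuous_map_compose[OF this L(1)[OF that(1)]] show ?thesis
      by (simp add: o_def)
  qed
  have agree: "L a w = L b w"
    if ab: "a \<in> topspace A" "b \<in> topspace A" and w: "w \<in> topspace ?P \<inter> {0..1} \<times> V a \<inter> {0..1} \<times> V b" for a b w
  proof -
    obtain t c where tc: "w = (t, c)" "t \<in> {0..1}" "c \<in> V a" "c \<in> V b"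
      using w by auto
    have "L a (t, c) = L b (t, c)"
    proof (rule lifts_unique[OF _ path[OF ab(1) tc(3)] path[OF ab(2) tc(4)]])
      show "connected_space unit_interval"
        by (simp add: connected_space_subtopology)
      show "p (L a (s, c)) = p (L b (s, c))" if "s \<in> topspace unit_interval" for s
        using that L(2)[OF ab(1), of "(s, c)"] L(2)[OF ab(2), of "(s, c)"] tc by simp
      show "L a (0, c) = L b (0, c)"
        using L(3) ab tc by simp
    qed (use tc in auto)
    then show ?thesis
      using tc(1) by simp
  qed
  obtain M where M: "continuous_map ?P X M"
    "\<And>w a. \<lbrakk>a \<in> topspace A; w \<in> topspace ?P \<inter> {0..1} \<times> V a\<rbrakk> \<Longrightarrow> M w = L a w"
  proof (rule pasting_lemma_exists[where X = ?P and I = "topspace A" and T = "\<lambda>a. {0..1} \<times> V a" and Y = X and f = L])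
    show "topspace ?P \<subseteq> (\<Union>a\<in>topspace A. {0..1} \<times> V a)"
      using V(2) by auto
    show "openin ?P ({0..1} \<times> V a)" if "a \<in> topspace A" for a
      using V(1)[OF that] openin_topspace[of unit_interval] by (simp add: openin_prod_Times_iff)
    show "continuous_map (subtopology ?P ({0..1} \<times> V a)) X (L a)" if "a \<in> topspace A" for a
      by (rule L(1)[OF that])
    show "L a w = L b w"
      if "a \<in> topspace A" "b \<in> topspace A" "w \<in> topspace ?P \<inter> {0..1} \<times> V a \<inter> {0..1} \<times> V b" for a b w
      by (rule agree[OF that])
  qed (rule that)
  show thesis
  proof (rule that[OF M(1)])
    show "p (M w) = H w" if "w \<in> topspace ?P" for w
      using that M(2)[of "snd w" w] L(2)[of "snd w" w] V(2)[of "snd w"] by (cases w) auto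
    show "M (0, a) = f a" if "a \<in> topspace A" for a
      using that M(2)[of a "(0, a)"] L(3)[of a a] V(2)[of a] by auto
  qed
qed

text \<open>The cylinder is cut into \<open>N\<close> slices so thin that each is locally evenly covered, and the lift is
  extended slice by slice.\<close>

theorem homotopy_lifting:
  assumes A: "compact_space A"
    and H: "continuous_map (prod_topology unit_interval A) Q H"
    and f: "continuous_map A X f" "\<And>a. a \<in> topspace A \<Longrightarrow> p (f a) = H (0, a)"
  obtains L where "continuous_map (prod_topology unit_interval A) X L"
    "\<And>w. w \<in> topspace (prod_topology unit_interval A) \<Longrightarrow> p (L w) = H w"
    "\<And>a. a \<in> topspace A \<Longrightarrow> L (0, a) = f a"
proof -
  let ?P = "prod_topology unit_interval A"
  let ?\<W> = "{W. openin ?P W \<and> evenly_covered (H ` W)}"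
  have "topspace ?P \<subseteq> \<Union>?\<W>"
  proof
    fix w assume w: "w \<in> topspace ?P"
    then have "H w \<in> topspace Q"
      using H by (auto simp: continuous_map_def)
    then obtain B where B: "openin Q B" "H w \<in> B" "evenly_covered B"
      using evenly_covered_nbhd by blast
    let ?W = "{w \<in> topspace ?P. H w \<in> B}"
    have "openin ?P ?W"
      by (rule openin_continuous_map_preimage[OF H B(1)])
    moreover have "H ` ?W \<subseteq> B"
      by blast
    then have "evenly_covered (H ` ?W)"
      using B(3) unfolding evenly_covered_def by (meson subset_trans)
    ultimately show "w \<in> \<Union>?\<W>"
      using w B(2) by blast
  qed
  then obtain N where N: "N > 0"
    "\<And>k a. \<lbrakk>k < N; a \<in> topspace A\<rbrakk> \<Longrightarrow>
       \<exists>V W. openin A V \<and> a \<in> V \<and> W \<in> ?\<W> \<and> {real k / real N..real (Suc k) / real N} \<times> V \<subseteq> W"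
    using compact_cylinder_subdivision[OF A, of ?\<W>] by blast
  \<comment> \<open>The homotopy is stopped at time k/N instead of restricted, so every stage lives on all of P.\<close>
  have "\<exists>L. continuous_map ?P X L \<and> (\<forall>t\<in>{0..1}. \<forall>a\<in>topspace A. p (L (t, a)) = H (min t (real k / real N), a))
          \<and> (\<forall>a\<in>topspace A. L (0, a) = f a)" if "k \<le> N" for k
    using that
  proof (induction k)
    case 0
    have "continuous_map ?P X (\<lambda>w. f (snd w))"
      using continuous_map_compose[OF continuous_map_snd f(1)] by (simp add: o_def)
    with f(2) show ?case
      by (intro exI[of _ "\<lambda>w. f (snd w)"]) auto
  next
    case (Suc k)
    then obtain L where L: "continuous_map ?P X L" "\<And>a. a \<in> topspace A \<Longrightarrow> L (0, a) = f a"
        "\<And>t a. \<lbrakk>t \<in> {0..1}; a \<in> topspace A\<rbrakk> \<Longrightarrow> p (L (t, a)) = H (min t (real k / real N), a)"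
      by fastforce
    define s where "s = real k / real N"
    define s' where "s' = real (Suc k) / real N"
    have s: "0 \<le> s" "s \<le> s'" "s' \<le> 1"
      using Suc.prems N(1) by (auto simp: s_def s'_def field_simps)
    \<comment> \<open>The k-th slice, traversed from time 0 and stopped at its end.\<close>
    let ?c = "\<lambda>w. (min (s + fst w) s', snd w)"
    have c: "continuous_map ?P ?P ?c"
      using s
      by (intro continuous_map_pairedI continuous_map_into_unit_interval continuous_map_real_min
            continuous_map_add continuous_map_fst_real continuous_map_snd) auto
    have "continuous_map A ?P (Pair s)"
      using s by (intro continuous_map_pairedI continuous_map_id[unfolded id_def]) auto
    then have Ls: "continuous_map A X (L \<circ> Pair s)"
      by (rule continuous_map_compose[OF _ L(1)])
    obtain M where M: "continuous_map ?P X M" "\<And>w. w \<in> topspace ?P \<Longrightarrow> p (M w) = (H \<circ> ?c) w"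
        "\<And>a. a \<in> topspace A \<Longrightarrow> M (0, a) = (L \<circ> Pair s) a"
    proof (rule lift_step[OF continuous_map_compose[OF c H] Ls])
      show "p ((L \<circ> Pair s) a) = (H \<circ> ?c) (0, a)" if "a \<in> topspace A" for a
        using L(3)[of s a] that s by (simp add: s_def[symmetric])
      show "\<exists>V. openin A V \<and> a \<in> V \<and> evenly_covered ((H \<circ> ?c) ` ({0..1} \<times> V))"
        if a: "a \<in> topspace A" for a
      proof -
        have "k < N" using Suc.prems by simp
        then obtain V W where V: "openin A V" "a \<in> V" "evenly_covered (H ` W)" "{s..s'} \<times> V \<subseteq> W"
          using N(2)[of k a] a unfolding s_def s'_def by blast
        have "?c ` ({0..1} \<times> V) \<subseteq> {s..s'} \<times> V"
          using s by auto
        then have "(H \<circ> ?c) ` ({0..1} \<times> V) \<subseteq> H ` W"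
          using V(4) by (auto simp only: image_comp[symmetric] image_mono)
        then have "evenly_covered ((H \<circ> ?c) ` ({0..1} \<times> V))"
          using V(3) unfolding evenly_covered_def by (meson subset_trans)
        with V show ?thesis by blast
      qed
    qed (rule that)
    let ?K = "\<lambda>w. if fst w \<le> s then L w else (M \<circ> (\<lambda>w. (fst w - s, snd w))) w"
    have "continuous_map ?P X ?K"
    proof (rule continuous_map_cases_le)
      show "continuous_map (subtopology ?P {w \<in> topspace ?P. fst w \<le> s}) X L"
        by (rule continuous_map_from_subtopology[OF L(1)])
      show "continuous_map (subtopology ?P {w \<in> topspace ?P. s \<le> fst w}) X (M \<circ> (\<lambda>w. (fst w - s, snd w)))"
      proof (rule continuous_map_compose[OF _ M(1)])
        show "continuous_map (subtopology ?P {w \<in> topspace ?P. s \<le> fst w}) ?P (\<lambda>w. (fst w - s, snd w))"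
          using s
          by (intro continuous_map_pairedI continuous_map_into_unit_interval continuous_map_diff
                continuous_map_from_subtopology continuous_map_fst_real continuous_map_snd) auto
      qed
      show "L w = (M \<circ> (\<lambda>w. (fst w - s, snd w))) w" if "w \<in> topspace ?P" "fst w = s" for w
        using that M(3)[of "snd w"] by (cases w) auto
    qed (simp_all add: continuous_map_fst_real)
    moreover have "p (?K (t, a)) = H (min t s', a)" if ta: "t \<in> {0..1}" "a \<in> topspace A" for t a
    proof (cases "t \<le> s")
      case True
      then show ?thesis
        using L(3)[OF ta] s by (simp add: s_def[symmetric])
    next
      case False
      then show ?thesis
        using M(2)[of "(t - s, a)"] ta s by simp
    qed
    moreover have "?K (0, a) = f a" if "a \<in> topspace A" for a
      using L(2)[OF that] s by simp
    ultimately show ?case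
      unfolding s'_def[symmetric] by (intro exI[of _ ?K] conjI ballI) blast+
  qed
  from this[of N] obtain L where L: "continuous_map ?P X L" "\<And>a. a \<in> topspace A \<Longrightarrow> L (0, a) = f a"
      "\<And>t a. \<lbrakk>t \<in> {0..1}; a \<in> topspace A\<rbrakk> \<Longrightarrow> p (L (t, a)) = H (min t (real N / real N), a)"
    by auto
  have "p (L w) = H w" if "w \<in> topspace ?P" for w
    using that L(3)[of "fst w" "snd w"] N(1) by (cases w) simp
  then show thesis
    using that L(1,2) by blast
qed

end

section \<open>Rhodes maps and loops in the mapping space\<close>

text \<open>A bijection that preserves products carries the group laws back along it; the Rhodes group inherits
  them from the Fox group in this way.\<close>

lemma group_transfer_bij:
  assumes F: "group F" and bij: "bij_betw h (carrier R) (carrier F)"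
    and closed: "\<And>x y. \<lbrakk>x \<in> carrier R; y \<in> carrier R\<rbrakk> \<Longrightarrow> x \<otimes>\<^bsub>R\<^esub> y \<in> carrier R"
    and hom: "\<And>x y. \<lbrakk>x \<in> carrier R; y \<in> carrier R\<rbrakk> \<Longrightarrow> h (x \<otimes>\<^bsub>R\<^esub> y) = h x \<otimes>\<^bsub>F\<^esub> h y"
    and one: "\<one>\<^bsub>R\<^esub> \<in> carrier R" "h \<one>\<^bsub>R\<^esub> = \<one>\<^bsub>F\<^esub>"
  shows "group R"
proof -
  interpret F: group F by (rule F)
  have inj: "x = y" if "x \<in> carrier R" "y \<in> carrier R" "h x = h y" for x y
    using bij that by (auto simp: bij_betw_def inj_on_def)
  have hF: "h x \<in> carrier F" if "x \<in> carrier R" for x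
    using bij that by (auto simp: bij_betw_def)
  show ?thesis
  proof (rule groupI)
    fix x assume x: "x \<in> carrier R"
    obtain y where y: "y \<in> carrier R" "h y = inv\<^bsub>F\<^esub> (h x)"
      using bij F.inv_closed[OF hF[OF x]] unfolding bij_betw_def by (metis imageE)
    have "y \<otimes>\<^bsub>R\<^esub> x = \<one>\<^bsub>R\<^esub>"
      by (rule inj) (use x y one closed hom hF in auto)
    with y show "\<exists>y\<in>carrier R. y \<otimes>\<^bsub>R\<^esub> x = \<one>\<^bsub>R\<^esub>" by blast
    show "\<one>\<^bsub>R\<^esub> \<otimes>\<^bsub>R\<^esub> x = x"
      by (rule inj) (use x one closed hom hF in auto)
  next
    fix x y z assume "x \<in> carrier R" "y \<in> carrier R" "z \<in> carrier R"
    then show "x \<otimes>\<^bsub>R\<^esub> y \<otimes>\<^bsub>R\<^esub> z = x \<otimes>\<^bsub>R\<^esub> (y \<otimes>\<^bsub>R\<^esub> z)"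
      by (intro inj) (simp_all add: closed hom hF F.m_assoc)
  qed (use closed one in auto)
qed

locale pointed_free_finite_action = free_finite_action G X \<phi>
  for G :: "('g, 'm) monoid_scheme" (structure) and X :: "'a topology" and \<phi> :: "'g \<Rightarrow> 'a \<Rightarrow> 'a" +
  fixes x0 :: 'a and n :: nat
  assumes x0: "x0 \<in> topspace X"
begin

abbreviation T :: "(nat \<Rightarrow> complex) topology" where "T \<equiv> torus (n - 1)"

abbreviation M :: "((nat \<Rightarrow> complex) \<Rightarrow> 'a set) topology" where "M \<equiv> mapping_space T Q"

abbreviation c :: "(nat \<Rightarrow> complex) \<Rightarrow> 'a set" where "c \<equiv> \<lambda>t\<in>topspace T. p x0"

abbreviation adj :: "(real \<times> (nat \<Rightarrow> complex) \<Rightarrow> 'a) \<Rightarrow> real \<Rightarrow> (nat \<Rightarrow> complex) \<Rightarrow> 'a set" where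
  "adj f \<equiv> adjoint_loop n (p \<circ> f)"

definition rhodes_map :: "'g \<Rightarrow> (real \<times> (nat \<Rightarrow> complex) \<Rightarrow> 'a) \<Rightarrow> bool" where
  "rhodes_map g f \<longleftrightarrow> g \<in> carrier G \<and> continuous_map (prod_topology unit_interval T) X f \<and> of_order n x0 \<phi> g f"

abbreviation rhodes_homotopic where
  "rhodes_homotopic g \<equiv> homotopic_with (of_order n x0 \<phi> g) (prod_topology unit_interval T) X"

lemma rhodes_mapD:
  assumes "rhodes_map g f"
  shows "g \<in> carrier G" "continuous_map (prod_topology unit_interval T) X f"
    "\<And>t. t \<in> topspace T \<Longrightarrow> f (0, t) = x0" "\<And>t. t \<in> topspace T \<Longrightarrow> f (1, t) = \<phi> g x0"
  using assms by (auto simp: rhodes_map_def of_order_def)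

lemma rhodes_homotopic_imp_map:
  assumes "rhodes_homotopic g f f'" "g \<in> carrier G"
  shows "rhodes_map g f" "rhodes_map g f'"
  using homotopic_with_imp_continuous_maps[OF assms(1)] homotopic_with_imp_property[OF assms(1)] assms(2)
  by (auto simp: rhodes_map_def)

lemma rhodes_homotopic_refl: "rhodes_map g f \<Longrightarrow> rhodes_homotopic g f f"
  by (simp add: rhodes_map_def)

lemma connected_cylinder: "connected_space (prod_topology unit_interval T)"
  using connected_space_torus[of "n - 1"] by (simp add: connected_space_prod_topology connected_space_subtopology)

lemma adj_apply: "t \<in> topspace T \<Longrightarrow> adj f s t = p (f (s, t))"
  by (simp add: adjoint_loop_def)

lemma adj_loop:
  assumes f: "rhodes_map g f"
  shows "continuous_map unit_interval M (adj f)" "loop_at c (adj f)"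
proof -
  show "continuous_map unit_interval M (adj f)"
    unfolding adjoint_loop_def
    by (rule continuous_map_curry[OF continuous_map_compose[OF rhodes_mapD(2)[OF f] continuous_map_p]])
  show "loop_at c (adj f)"
    unfolding loop_at_def adjoint_loop_def
    using rhodes_mapD[OF f] p_act x0 by (auto intro!: restrict_ext)
qed

lemma adj_homotopic:
  assumes "rhodes_homotopic g f f'" and g: "g \<in> carrier G"
  shows "loop_homotopic M c (adj f) (adj f')"
proof -
  let ?C = "prod_topology unit_interval T" and ?S = "prod_topology unit_interval unit_interval"
  obtain h where h: "continuous_map (prod_topology unit_interval ?C) X h"
      "\<And>x. h (0, x) = f x" "\<And>x. h (1, x) = f' x" "\<And>u. u \<in> {0..1} \<Longrightarrow> of_order n x0 \<phi> g (\<lambda>x. h (u, x))"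
    using assms(1) by (auto simp: homotopic_with_def)
  let ?assoc = "\<lambda>w. (fst (fst w), (snd (fst w), snd w)) :: real \<times> real \<times> (nat \<Rightarrow> complex)"
  have "continuous_map (prod_topology ?S T) (prod_topology unit_interval ?C) ?assoc"
    by (intro continuous_map_pairedI continuous_map_snd
          continuous_map_compose[OF continuous_map_fst continuous_map_fst, unfolded o_def]
          continuous_map_compose[OF continuous_map_fst continuous_map_snd, unfolded o_def])
  from continuous_map_curry[OF continuous_map_compose[OF continuous_map_compose[OF this h(1)] continuous_map_p]]
  have k: "continuous_map ?S M (\<lambda>w. \<lambda>t\<in>topspace T. p (h (fst w, (snd w, t))))"
    by (simp add: o_def)
  show ?thesis
    unfolding homotopic_with_def
  proof (intro exI[of _ "\<lambda>w. \<lambda>t\<in>topspace T. p (h (fst w, (snd w, t)))"] conjI allI ballI k)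
    fix u :: real assume "u \<in> {0..1}"
    from h(4)[OF this] show "loop_at c (\<lambda>s. \<lambda>t\<in>topspace T. p (h (fst (u, s), (snd (u, s), t))))"
      using p_act[OF g x0] unfolding of_order_def loop_at_def by (auto intro!: restrict_ext)
  qed (simp_all add: adjoint_loop_def h)
qed

text \<open>The homotopy \<open>k\<close> of loops is lifted along the loop parameter \<open>s\<close>, starting from the constant map at
  \<open>x0\<close>, with the homotopy parameter \<open>u\<close> and the torus point \<open>t\<close> as parameters. At \<open>u = 0\<close> and
  \<open>u = 1\<close> the lift is \<open>f\<close> and \<open>f'\<close>, by uniqueness. At \<open>s = 1\<close> it lifts a constant map on the
  connected cylinder, so it is constant; this is what forces \<open>g = g'\<close> and keeps the homotopy
  within the maps of order \<open>g\<close>.\<close>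

lemma adj_homotopic_imp:
  assumes f: "rhodes_map g f" and f': "rhodes_map g' f'"
    and hom: "loop_homotopic M c (adj f) (adj f')"
  shows "g = g'" and "rhodes_homotopic g f f'"
proof -
  let ?C = "prod_topology unit_interval T" and ?S = "prod_topology unit_interval unit_interval"
  obtain k where k: "continuous_map ?S M k" "\<And>s. k (0, s) = adj f s" "\<And>s. k (1, s) = adj f' s"
      "\<And>u. u \<in> {0..1} \<Longrightarrow> loop_at c (\<lambda>s. k (u, s))"
    using hom by (auto simp: homotopic_with_def)
  have K: "continuous_map (prod_topology ?S T) Q (\<lambda>(w, t). k w t)"
    by (rule continuous_map_uncurry[OF torus_compact_neighbourhoods k(1)])
  \<comment> \<open>H has the arguments s, u, t in this order: lifting proceeds along s.\<close>
  let ?perm = "\<lambda>w. ((fst (snd w), fst w), snd (snd w)) :: (real \<times> real) \<times> (nat \<Rightarrow> complex)"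
  have "continuous_map (prod_topology unit_interval ?C) (prod_topology ?S T) ?perm"
    by (intro continuous_map_pairedI continuous_map_fst
          continuous_map_compose[OF continuous_map_snd continuous_map_fst, unfolded o_def]
          continuous_map_compose[OF continuous_map_snd continuous_map_snd, unfolded o_def])
  from continuous_map_compose[OF this K]
  have H: "continuous_map (prod_topology unit_interval ?C) Q (\<lambda>w. k (fst (snd w), fst w) (snd (snd w)))"
    (is "continuous_map _ _ ?H")
    by (simp add: o_def)
  have C: "compact_space ?C"
    using compact_space_torus[of "n - 1"] by (simp add: compact_space_prod_topology compact_space_subtopology)
  have const: "continuous_map ?C X (\<lambda>_. x0)"
    using x0 by simp
  have "p x0 = ?H (0, a)" if "a \<in> topspace ?C" for a
    using that k(4)[of "fst a"] by (cases a) (simp add: loop_at_def)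
  then obtain L where L: "continuous_map (prod_topology unit_interval ?C) X L"
      "\<And>w. w \<in> topspace (prod_topology unit_interval ?C) \<Longrightarrow> p (L w) = ?H w"
      "\<And>a. a \<in> topspace ?C \<Longrightarrow> L (0, a) = x0"
    using homotopy_lifting[OF C H const] by blast
  obtain t0 where t0: "t0 \<in> topspace T"
    using torus_nonempty by blast
  have slice: "continuous_map ?C X (\<lambda>w. L (fst w, (u, snd w)))" if "u \<in> {0..1}" for u
  proof -
    have "continuous_map ?C (prod_topology unit_interval ?C) (\<lambda>w. (fst w, (u, snd w)))"
      using that by (intro continuous_map_pairedI continuous_map_fst continuous_map_snd) simp_all
    from continuous_map_compose[OF this L(1)] show ?thesis by (simp add: o_def)
  qed
  have end_lift: "L (s, (u, t)) = q (s, t)"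
    if q: "rhodes_map g'' q" and ku: "\<And>s. k (u, s) = adj q s" and u: "u \<in> {0..1}"
      and st: "s \<in> {0..1}" "t \<in> topspace T" for q g'' u s t
  proof -
    have "L (fst (s, t), (u, snd (s, t))) = q (s, t)"
    proof (rule lifts_unique[OF connected_cylinder slice[OF u] rhodes_mapD(2)[OF q], of "(0, t)"])
      show "p (L (fst y, (u, snd y))) = p (q y)" if "y \<in> topspace ?C" for y
        using that u L(2)[of "(fst y, (u, snd y))"] by (cases y) (simp add: ku adj_apply)
      show "L (fst (0, t), (u, snd (0, t))) = q (0, t)"
        using u st L(3)[of "(u, t)"] rhodes_mapD(3)[OF q st(2)] by simp
    qed (use st in auto)
    then show ?thesis by simp
  qed
  have L0: "L (s, (0, t)) = f (s, t)" if "s \<in> {0..1}" "t \<in> topspace T" for s t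
    by (rule end_lift[OF f k(2) _ that]) simp
  have L1: "L (s, (1, t)) = f' (s, t)" if "s \<in> {0..1}" "t \<in> topspace T" for s t
    by (rule end_lift[OF f' k(3) _ that]) simp
  have Lend: "L (1, a) = \<phi> g x0" if a: "a \<in> topspace ?C" for a
  proof -
    have "(L \<circ> Pair 1) a = \<phi> g x0"
    proof (rule lifts_unique[OF connected_cylinder, of "L \<circ> Pair 1" "\<lambda>_. \<phi> g x0" "(0, t0)"])
      show "continuous_map ?C X (L \<circ> Pair 1)"
        by (rule continuous_map_o_Pair[OF L(1)]) simp
      show "continuous_map ?C X (\<lambda>_. \<phi> g x0)"
        using act_closed[OF rhodes_mapD(1)[OF f] x0] by simp
      show "p ((L \<circ> Pair 1) y) = p (\<phi> g x0)" if "y \<in> topspace ?C" for y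
        using that L(2)[of "(1, y)"] k(4)[of "fst y"] p_act[OF rhodes_mapD(1)[OF f] x0]
        by (cases y) (simp add: loop_at_def)
      show "(L \<circ> Pair 1) (0, t0) = \<phi> g x0"
        using L0[of 1 t0] t0 rhodes_mapD(4)[OF f t0] by simp
    qed (use a t0 in auto)
    then show ?thesis by simp
  qed
  have "\<phi> g x0 = \<phi> g' x0"
    using Lend[of "(1, t0)"] L1[of 1 t0] t0 rhodes_mapD(4)[OF f' t0] by simp
  then show "g = g'"
    by (rule act_inj[OF rhodes_mapD(1)[OF f] rhodes_mapD(1)[OF f'] x0])
  \<comment> \<open>Back to the order u, s, t of a homotopy of maps on the cylinder.\<close>
  let ?swap = "\<lambda>w. (fst (snd w), (fst w, snd (snd w))) :: real \<times> real \<times> (nat \<Rightarrow> complex)"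
  have "continuous_map (prod_topology unit_interval ?C) (prod_topology unit_interval ?C) ?swap"
    by (intro continuous_map_pairedI continuous_map_fst
          continuous_map_compose[OF continuous_map_snd continuous_map_fst, unfolded o_def]
          continuous_map_compose[OF continuous_map_snd continuous_map_snd, unfolded o_def])
  from continuous_map_compose[OF this L(1)]
  have "continuous_map (prod_topology unit_interval ?C) X (L \<circ> ?swap)" .
  then show "rhodes_homotopic g f f'"
    by (subst homotopic_with, fastforce simp: of_order_def)
       (intro exI[of _ "L \<circ> ?swap"], use L0 L1 L(3) Lend in \<open>auto simp: of_order_def\<close>)
qed

text \<open>The end of the lift is a lift of a constant map on the connected torus, hence constant; its value
  is in the orbit of \<open>x0\<close> and determines \<open>g\<close>.\<close>

lemma adj_surj:
  assumes r: "continuous_map unit_interval M r" "loop_at c r"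
  obtains g f where "rhodes_map g f" "loop_class M c (adj f) = loop_class M c r"
proof -
  let ?C = "prod_topology unit_interval T"
  have R: "continuous_map ?C Q (\<lambda>(s, t). r s t)"
    by (rule continuous_map_uncurry[OF torus_compact_neighbourhoods r(1)])
  have const: "continuous_map T X (\<lambda>_. x0)"
    using x0 by simp
  have "p x0 = (\<lambda>(s, t). r s t) (0, t)" if "t \<in> topspace T" for t
    using that r(2) by (simp add: loop_at_def)
  then obtain L where L: "continuous_map ?C X L"
      "\<And>w. w \<in> topspace ?C \<Longrightarrow> p (L w) = (\<lambda>(s, t). r s t) w"
      "\<And>t. t \<in> topspace T \<Longrightarrow> L (0, t) = x0"
    using homotopy_lifting[OF compact_space_torus R const] by blast
  obtain t0 where t0: "t0 \<in> topspace T"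
    using torus_nonempty by blast
  have LX: "L w \<in> topspace X" if "w \<in> topspace ?C" for w
    using L(1) that by (auto simp: continuous_map_def)
  have pL: "p (L (1, t)) = p x0" if "t \<in> topspace T" for t
    using L(2)[of "(1, t)"] that r(2) by (simp add: loop_at_def)
  obtain g where g: "g \<in> carrier G" "L (1, t0) = \<phi> g x0"
    using p_eq_obtain[OF x0 LX[of "(1, t0)"]] pL[OF t0] t0 by auto
  have Lend: "L (1, t) = \<phi> g x0" if t: "t \<in> topspace T" for t
  proof -
    have "(L \<circ> Pair 1) t = \<phi> g x0"
    proof (rule lifts_unique[OF connected_space_torus, of "n - 1" "L \<circ> Pair 1" "\<lambda>_. \<phi> g x0" t0])
      show "continuous_map T X (L \<circ> Pair 1)"
        by (rule continuous_map_o_Pair[OF L(1)]) simp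
      show "continuous_map T X (\<lambda>_. \<phi> g x0)"
        using act_closed[OF g(1) x0] by simp
    qed (use t t0 g pL p_act x0 in auto)
    then show ?thesis by simp
  qed
  have map: "rhodes_map g L"
    unfolding rhodes_map_def of_order_def using g(1) L(1,3) Lend by blast
  have "adj L s = r s" if s: "s \<in> {0..1}" for s
  proof
    fix t
    have "r s \<in> maps T Q"
      using r(1) s topspace_mapping_space[of T Q] by (auto simp: continuous_map_def)
    then show "adj L s t = r s t"
      using L(2)[of "(s, t)"] s by (cases "t \<in> topspace T")
        (auto simp: adjoint_loop_def maps_def extensional_def)
  qed
  then have "loop_class M c (adj L) = loop_class M c r"
    by (intro loop_class_eqI adj_loop[OF map])
  with map show thesis by (rule that)
qed

lemma rhodes_map_concat:
  assumes f': "rhodes_map g' f'" and f: "rhodes_map g f"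
  shows "rhodes_map (g' \<otimes> g) (cyl_concat f' (\<phi> g' \<circ> f))"
    and "loop_class M c (adj (cyl_concat f' (\<phi> g' \<circ> f))) = loop_class M c (loop_concat (adj f') (adj f))"
proof -
  have cont: "continuous_map (prod_topology unit_interval T) X (\<phi> g' \<circ> f)"
    by (rule continuous_map_compose[OF rhodes_mapD(2)[OF f] act_continuous[OF rhodes_mapD(1)[OF f']]])
  show map: "rhodes_map (g' \<otimes> g) (cyl_concat f' (\<phi> g' \<circ> f))"
    unfolding rhodes_map_def of_order_def
  proof (intro conjI ballI)
    show "continuous_map (prod_topology unit_interval T) X (cyl_concat f' (\<phi> g' \<circ> f))"
      by (intro continuous_map_cyl_concat rhodes_mapD(2)[OF f'] cont)
         (simp add: rhodes_mapD(3)[OF f] rhodes_mapD(4)[OF f'])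
  qed (use rhodes_mapD[OF f] rhodes_mapD[OF f'] x0 in \<open>auto simp: cyl_concat_def composition_rule\<close>)
  have "adj (cyl_concat f' (\<phi> g' \<circ> f)) s = loop_concat (adj f') (adj f) s" if s: "s \<in> {0..1}" for s
  proof -
    have "p (\<phi> g' (f (2 * s - 1, t))) = p (f (2 * s - 1, t))" if "\<not> s \<le> 1/2" "t \<in> topspace T" for t
      using that s rhodes_mapD(2)[OF f]
      by (intro p_act rhodes_mapD(1)[OF f']) (auto simp: continuous_map_def)
    then show ?thesis
      by (auto simp: adjoint_loop_def loop_concat_def cyl_concat_def intro!: restrict_ext)
  qed
  then show "loop_class M c (adj (cyl_concat f' (\<phi> g' \<circ> f))) = loop_class M c (loop_concat (adj f') (adj f))"
    by (intro loop_class_eqI adj_loop[OF map])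
qed

abbreviation rclass where "rclass \<equiv> \<lambda>f g. rhodes_class n X x0 \<phi> f g"

lemma rclass_eq: "rclass f g = ({f'. rhodes_homotopic g f f'}, g)"
  by (simp add: rhodes_class_def cylinder_def)

text \<open>Projection is injective on classes. Every later question about Rhodes classes is decided in the
  mapping space by this equivalence.\<close>

lemma rclass_eq_iff:
  assumes f: "rhodes_map g f" and f': "rhodes_map g' f'"
  shows "rclass f g = rclass f' g' \<longleftrightarrow> loop_class M c (adj f) = loop_class M c (adj f')"
proof
  assume eq: "rclass f g = rclass f' g'"
  have "f' \<in> {q. rhodes_homotopic g' f' q}"
    by (simp only: mem_Collect_eq rhodes_homotopic_refl[OF f'])
  moreover have "{q. rhodes_homotopic g f q} = {q. rhodes_homotopic g' f' q}"
    using eq unfolding rclass_eq prod.inject by (rule conjunct1)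
  ultimately have "f' \<in> {q. rhodes_homotopic g f q}"
    by (rule equalityD2[THEN subsetD, rotated])
  then have "rhodes_homotopic g f f'"
    by (rule CollectD)
  from adj_homotopic[OF this rhodes_mapD(1)[OF f]]
  show "loop_class M c (adj f) = loop_class M c (adj f')"
    by (rule loop_homotopic_imp_class_eq)
next
  assume "loop_class M c (adj f) = loop_class M c (adj f')"
  then have "loop_homotopic M c (adj f) (adj f')"
    using loop_class_eq_iff[OF adj_loop[OF f']] by simp
  note g = adj_homotopic_imp(1)[OF f f' this] and h = adj_homotopic_imp(2)[OF f f' this]
  have "rhodes_homotopic g f q \<longleftrightarrow> rhodes_homotopic g f' q" for q
    using homotopic_with_trans[OF h, of q] homotopic_with_trans[OF homotopic_with_symD[OF h], of q] by blast
  then have "{q. rhodes_homotopic g f q} = {q. rhodes_homotopic g f' q}"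
    by (intro Collect_cong)
  then show "rclass f g = rclass f' g'"
    unfolding rclass_eq by (simp only: g)
qed

abbreviation R where "R \<equiv> rhodes_group n X x0 G \<phi>"

abbreviation F where "F \<equiv> fox_group n Q (p x0)"

lemma carrier_R: "carrier R = {rclass f g | f g. rhodes_map g f}"
  by (auto simp: rhodes_group_def rhodes_map_def cylinder_def)

lemma carrier_F: "carrier F = {loop_class M c r | r. continuous_map unit_interval M r \<and> loop_at c r}"
  by (simp add: fox_group_def fundamental_group_def)

lemma induced_class:
  assumes f: "rhodes_map g f"
  shows "orbit_map_induced n X x0 G \<phi> (rclass f g) = loop_class M c (adj f)"
proof -
  have eq: "loop_class M c (adj f') = loop_class M c (adj f)" if "rhodes_homotopic g f f'" for f'
    using loop_homotopic_imp_class_eq[OF adj_homotopic[OF that rhodes_mapD(1)[OF f]]] by simp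
  have "{f'. rhodes_homotopic g f f'} \<noteq> {}"
    using rhodes_homotopic_refl[OF f] by blast
  then have const: "(\<Union>f'\<in>{f'. rhodes_homotopic g f f'}. S) = S" for S :: "(real \<Rightarrow> (nat \<Rightarrow> complex) \<Rightarrow> 'a set) set"
    by (simp only: UN_constant if_False)
  have "orbit_map_induced n X x0 G \<phi> (rclass f g)
      = (\<Union>f'\<in>{f'. rhodes_homotopic g f f'}. loop_class M c (adj f'))"
    by (simp add: orbit_map_induced_def rclass_eq)
  also have "\<dots> = (\<Union>f'\<in>{f'. rhodes_homotopic g f f'}. loop_class M c (adj f))"
    by (intro SUP_cong refl eq) (erule CollectD)
  also have "\<dots> = loop_class M c (adj f)"
    by (rule const)
  finally show ?thesis .
qed

text \<open>The union that defines the product is a single class: other representatives give the same loop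
  class after projection, and projection is injective on classes.\<close>

lemma rhodes_mult:
  assumes f': "rhodes_map g' f'" and f: "rhodes_map g f"
  shows "rclass f' g' \<otimes>\<^bsub>R\<^esub> rclass f g = rclass (cyl_concat f' (\<phi> g' \<circ> f)) (g' \<otimes> g)"
proof -
  let ?A = "{q'. rhodes_homotopic g' f' q'}" and ?B = "{q. rhodes_homotopic g f q}"
  have eq: "rclass (cyl_concat q' (\<phi> g' \<circ> q)) (g' \<otimes> g) = rclass (cyl_concat f' (\<phi> g' \<circ> f)) (g' \<otimes> g)"
    if "q' \<in> ?A" "q \<in> ?B" for q' q
  proof -
    have hom: "rhodes_homotopic g' f' q'" "rhodes_homotopic g f q"
      using that by simp_all
    have q': "rhodes_map g' q'" and q: "rhodes_map g q"
      using rhodes_homotopic_imp_map(2)[OF hom(1) rhodes_mapD(1)[OF f']]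
        rhodes_homotopic_imp_map(2)[OF hom(2) rhodes_mapD(1)[OF f]] by simp_all
    have "loop_class M c (loop_concat (adj f') (adj f)) = loop_class M c (loop_concat (adj q') (adj q))"
      by (intro loop_homotopic_imp_class_eq loop_homotopic_concat
            adj_homotopic[OF hom(1) rhodes_mapD(1)[OF f']] adj_homotopic[OF hom(2) rhodes_mapD(1)[OF f]])
    then show ?thesis
      using rclass_eq_iff[OF rhodes_map_concat(1)[OF q' q] rhodes_map_concat(1)[OF f' f]]
        rhodes_map_concat(2)[OF q' q] rhodes_map_concat(2)[OF f' f] by simp
  qed
  have "?A \<noteq> {}" "?B \<noteq> {}"
    using rhodes_homotopic_refl[OF f'] rhodes_homotopic_refl[OF f] by blast+
  then have const: "(\<Union>q'\<in>?A. \<Union>q\<in>?B. S) = S" for S :: "(real \<times> (nat \<Rightarrow> complex) \<Rightarrow> 'a) set"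
    by (simp only: UN_constant if_False)
  have "rclass f' g' \<otimes>\<^bsub>R\<^esub> rclass f g
      = (\<Union>q'\<in>?A. \<Union>q\<in>?B. fst (rclass (cyl_concat q' (\<phi> g' \<circ> q)) (g' \<otimes> g)), g' \<otimes> g)"
    by (simp add: rhodes_group_def rclass_eq)
  also have "(\<Union>q'\<in>?A. \<Union>q\<in>?B. fst (rclass (cyl_concat q' (\<phi> g' \<circ> q)) (g' \<otimes> g)))
      = (\<Union>q'\<in>?A. \<Union>q\<in>?B. fst (rclass (cyl_concat f' (\<phi> g' \<circ> f)) (g' \<otimes> g)))"
    by (intro SUP_cong refl arg_cong[where f = fst] eq)
  also have "\<dots> = fst (rclass (cyl_concat f' (\<phi> g' \<circ> f)) (g' \<otimes> g))"
    by (rule const)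
  finally show ?thesis
    by (simp only: rclass_eq fst_conv)
qed

theorem orbit_map_induced_iso:
  "group R" "group F" "orbit_map_induced n X x0 G \<phi> \<in> iso R F"
proof -
  let ?h = "orbit_map_induced n X x0 G \<phi>"
  have "p x0 \<in> topspace Q"
    using x0 unfolding topspace_orbit_space orbits_def by blast
  then have "continuous_map T Q (\<lambda>_. p x0)"
    by simp
  then have "continuous_map T Q c"
    by (rule continuous_map_eq) simp
  then have "c \<in> topspace M"
    unfolding topspace_mapping_space maps_def by simp
  then show F: "group F"
    unfolding fox_group_def by (rule group_fundamental_group)
  have bij: "bij_betw ?h (carrier R) (carrier F)"
    unfolding bij_betw_def
  proof
    show "inj_on ?h (carrier R)"
    proof (rule inj_onI)
      fix x y assume "x \<in> carrier R" "y \<in> carrier R" and eq: "?h x = ?h y"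
      then obtain f g f' g' where x: "x = rclass f g" "rhodes_map g f" and y: "y = rclass f' g'" "rhodes_map g' f'"
        unfolding carrier_R by blast
      show "x = y"
        using eq unfolding x(1) y(1) induced_class[OF x(2)] induced_class[OF y(2)]
          rclass_eq_iff[OF x(2) y(2)] .
    qed
    show "?h ` carrier R = carrier F"
    proof (intro equalityI subsetI)
      fix y assume "y \<in> ?h ` carrier R"
      then obtain f g where fg: "rhodes_map g f" "y = ?h (rclass f g)"
        unfolding carrier_R by blast
      show "y \<in> carrier F"
        unfolding carrier_F fg(2) induced_class[OF fg(1)] using adj_loop[OF fg(1)] by auto
    next
      fix y assume "y \<in> carrier F"
      then obtain r where r: "continuous_map unit_interval M r" "loop_at c r" "y = loop_class M c r"
        unfolding carrier_F by auto
      obtain g f where f: "rhodes_map g f" "loop_class M c (adj f) = loop_class M c r"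
        using adj_surj[OF r(1,2)] by blast
      then have "y = ?h (rclass f g)"
        unfolding induced_class[OF f(1)] r(3) by simp
      then show "y \<in> ?h ` carrier R"
        unfolding carrier_R using f(1) by blast
    qed
  qed
  have closed: "x \<otimes>\<^bsub>R\<^esub> y \<in> carrier R" and hom: "?h (x \<otimes>\<^bsub>R\<^esub> y) = ?h x \<otimes>\<^bsub>F\<^esub> ?h y"
    if xy: "x \<in> carrier R" "y \<in> carrier R" for x y
  proof -
    obtain f g f' g' where x: "x = rclass f' g'" "rhodes_map g' f'" and y: "y = rclass f g" "rhodes_map g f"
      using xy unfolding carrier_R by blast
    note map = rhodes_map_concat[OF x(2) y(2)]
    show "x \<otimes>\<^bsub>R\<^esub> y \<in> carrier R"
      unfolding x(1) y(1) rhodes_mult[OF x(2) y(2)] carrier_R using map(1) by blast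
    show "?h (x \<otimes>\<^bsub>R\<^esub> y) = ?h x \<otimes>\<^bsub>F\<^esub> ?h y"
      unfolding x(1) y(1) rhodes_mult[OF x(2) y(2)] induced_class[OF map(1)] induced_class[OF x(2)]
        induced_class[OF y(2)] fox_group_def fundamental_group_mult[OF adj_loop[OF x(2)] adj_loop[OF y(2)]]
      by (rule map(2))
  qed
  have triv: "rhodes_map \<one> (\<lambda>_. x0)"
    using x0 by (simp add: rhodes_map_def of_order_def act_one)
  have oneR: "\<one>\<^bsub>R\<^esub> = rclass (\<lambda>_. x0) \<one>"
    by (simp add: rhodes_group_def)
  have oneF: "?h \<one>\<^bsub>R\<^esub> = \<one>\<^bsub>F\<^esub>"
    unfolding oneR induced_class[OF triv]
    by (simp add: fox_group_def fundamental_group_def adjoint_loop_def)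
  show "group R"
    by (rule group_transfer_bij[OF F bij closed hom _ oneF]) (use triv in \<open>auto simp: oneR carrier_R\<close>)
  show "?h \<in> iso R F"
    unfolding iso_def hom_def using bij hom by (auto simp: bij_betw_def)
qed

end

theorem theorem1p2:
  fixes G :: "('g, 'm) monoid_scheme"
    and X :: "'a topology"
    and \<phi> :: "'g \<Rightarrow> 'a \<Rightarrow> 'a"
    and x0 :: 'a
    and n :: nat
  assumes "group G" and "finite (carrier G)"
    and "G_space G X \<phi>" and "free_action G X \<phi>"
    and "k_space X" and "Hausdorff_space X" and "path_connected_space X"
    and "x0 \<in> topspace X"
    and "n \<ge> 1"
  shows "group_hom (rhodes_group n X x0 G \<phi>) (fox_group n (orbit_space G \<phi> X) (orbit G \<phi> x0))
           (orbit_map_induced n X x0 G \<phi>)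
       \<and> orbit_map_induced n X x0 G \<phi>
           \<in> iso (rhodes_group n X x0 G \<phi>) (fox_group n (orbit_space G \<phi> X) (orbit G \<phi> x0))"
proof -
  interpret pointed_free_finite_action G X \<phi> x0 n
    by unfold_locales (use assms in auto)
  have "orbit_map_induced n X x0 G \<phi> \<in> hom R F"
    using orbit_map_induced_iso(3) by (simp add: iso_def)
  then have "group_hom R F (orbit_map_induced n X x0 G \<phi>)"
    by (intro group_hom.intro group_hom_axioms.intro orbit_map_induced_iso)
  then show ?thesis
    using orbit_map_induced_iso(3) by blast
qed

end
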